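(* The complexity of (1,2)Insertion is at most $n \lg n - 1.40118n$.
   Context: Complexity means the expected number of comparisons over all $n!$ orderings of $n$ distinct input elements (uniformly random input); $n$ is assumed even and $O(\log n)$ terms are ignored. Notation: $\lg=\log_2$, and for real $x>0$, $p_x = x/2^{\lceil \lg x\rceil}\in(1/2,1]$. RHBS$(A,T)$ (right-heavy binary search) inserts $A$ into a sorted $T=(t_1,\dots,t_i)$: if $i\le 3\cdot 2^{\lceil\lg(i+1)\rceil-2}-1$ let $d=2^{\lceil\lg(i+1)\rceil-2}$, otherwise $d=i-2^{\lceil\lg(i+1)\rceil-1}+1$; compare $A$ with $t_d$ and recurse into $(t_1,\dots,t_{d-1})$ or $(t_{d+1},\dots,t_i)$. 2Merge$(A,B,T)$ with $T=(t_1,\dots,t_{i-2})$ sorted, $i$ even, $i\ge4$: Step 1 compare $A,B$ and swap so that $A<B$. Step 2: with $\alpha(r)=1-2^{-r/2}$, for $r=1,2,\dots$ up to $2\lg i$ compare $A$ with $t_{\lceil\alpha(r)i\rceil}$ and stop at the first $r$ with $A<t_{\lceil\alpha(r)i\rceil}$. Step 3: insert $A$ into $(t_{\lceil\alpha(r-1)i\rceil+1},\dots,t_{\lceil\alpha(r)i\rceil-1})$ by RHBS; say $A$ falls between $t_\ell$ and $t_{\ell+1}$. Step 4: insert $B$ into $(t_{\ell+1},\dots,t_{i-2})$ by RHBS. (1,2)Insertion$(S)$, $S=(s_1,\dots,s_n)$, $n$ even: if $n=2$ sort with one comparison; otherwise sort $(s_1,\dots,s_{n-2})$ recursively by (1,2)Insertion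 to get $T'$; if $p_n\in[0.5511,0.888]$ insert $s_{n-1},s_n$ into $T'$ by 2Merge$(s_{n-1},s_n,T')$, otherwise insert $s_{n-1}$ by RHBS and then $s_n$ by RHBS. *)

theory Defs
  imports Complex_Main "HOL-Combinatorics.Multiset_Permutations"
begin

text \<open>Elements are drawn from a linear order; comparisons are "a < b" queries.
  Sorted sequences are lists, t_j (1-based) is T ! (j - 1).\<close>

definition clg :: "real \<Rightarrow> nat" where
  "clg x = nat \<lceil>log 2 x\<rceil>"

definition p_of :: "real \<Rightarrow> real" where
  "p_of x = x / 2 ^ clg x"

text \<open>Pivot index d (1-based) of RHBS on a sorted list of length i \<ge> 1.
  With k = ceil(lg(i+1)): if i \<le> 3*2^(k-2) - 1 then d = 2^(k-2), else
  d = i - 2^(k-1) + 1.  (For i = 1, k = 1 and the first test reads 1 \<le> 1/2,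
  which is false; this is why the first branch also requires k \<ge> 2.)\<close>
definition rhbs_pivot :: "nat \<Rightarrow> nat" where
  "rhbs_pivot i =
     (let k = clg (real (i + 1)) in
      if 2 \<le> k \<and> i + 1 \<le> 3 * 2 ^ (k - 2) then 2 ^ (k - 2) else i + 1 - 2 ^ (k - 1))"

text \<open>RHBS(a, T): returns (number of elements of T smaller than a, i.e. the
  insertion position, and the number of comparisons made).  The first argument
  is a fuel parameter (called with length T; each step shrinks the list).\<close>
fun rhbs_aux :: "nat \<Rightarrow> 'a::linorder \<Rightarrow> 'a list \<Rightarrow> nat \<times> nat" where
  "rhbs_aux 0 a T = (0, 0)"
| "rhbs_aux (Suc f) a T =
     (if T = [] then (0, 0) else
      (let d = rhbs_pivot (length T) in
       if a < T ! (d - 1) then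
         (case rhbs_aux f a (take (d - 1) T) of (p, c) \<Rightarrow> (p, c + 1))
       else
         (case rhbs_aux f a (drop d T) of (p, c) \<Rightarrow> (d + p, c + 1))))"

definition rhbs :: "'a::linorder \<Rightarrow> 'a list \<Rightarrow> nat \<times> nat" where
  "rhbs a T = rhbs_aux (length T) a T"

definition alpha_idx :: "nat \<Rightarrow> nat \<Rightarrow> nat" where
  "alpha_idx r i = nat \<lceil>(1 - 2 powr (- real r / 2)) * real i\<rceil>"

definition merge_rounds :: "nat \<Rightarrow> nat" where
  "merge_rounds i = nat \<lfloor>2 * log 2 (real i)\<rfloor>"

text \<open>scan k a T i r: performs step-2 rounds r, r+1, ... (at most k of them);
  returns (the stopping round, number of comparisons).  If all rounds are
  exhausted without stopping, the returned round is merge_rounds i + 1.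
  Convention: if the probed index exceeds length T (the element would be one of
  the nonexistent t_(i-1), t_i), the probe is treated as t = +infinity: the scan
  stops there without a comparison.\<close>
fun scan :: "nat \<Rightarrow> 'a::linorder \<Rightarrow> 'a list \<Rightarrow> nat \<Rightarrow> nat \<Rightarrow> nat \<times> nat" where
  "scan 0 a T i r = (r, 0)"
| "scan (Suc k) a T i r =
     (let j = alpha_idx r i in
      if length T < j then (r, 0)
      else if a < T ! (j - 1) then (r, 1)
      else (case scan k a T i (r + 1) of (r', c) \<Rightarrow> (r', c + 1)))"

definition merge2_cost :: "'a::linorder \<Rightarrow> 'a \<Rightarrow> 'a list \<Rightarrow> nat" where
  "merge2_cost a0 b0 T =
     (let i = length T + 2;
          a = min a0 b0; b = max a0 b0;
          R = merge_rounds i;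
          (r, c2) = scan R a T i 1;
          lo = alpha_idx (r - 1) i;
          hi = (if r \<le> R then min (alpha_idx r i - 1) (length T) else length T);
          (p, c3) = rhbs a (take (hi - lo) (drop lo T));
          l = lo + p;
          (q, c4) = rhbs b (drop l T)
      in 1 + c2 + c3 + c4)"

text \<open>Number of comparisons of (1,2)Insertion on the input sequence xs
  (of even length).  The sorted intermediate list T' is the (correct) output of
  the recursive call, i.e. sort of the prefix.\<close>
fun ins12_cost :: "'a::linorder list \<Rightarrow> nat" where
  "ins12_cost xs =
     (if length xs \<le> 2 then 1 else
      (let n = length xs;
           pre = take (n - 2) xs;
           T' = sort pre;
           x = xs ! (n - 2); y = xs ! (n - 1)
       in ins12_cost pre +
          (if 0.5511 \<le> p_of (real n) \<and> p_of (real n) \<le> 0.888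
           then merge2_cost x y T'
           else snd (rhbs x T') + snd (rhbs y (insort x T')))))"

definition avg_ins12 :: "nat \<Rightarrow> real" where
  "avg_ins12 n =
     (\<Sum>xs\<in>permutations_of_set {0..<n}. real (ins12_cost xs)) / fact n"

end

theory Submission
  imports Defs "HOL-Analysis.Harmonic_Numbers"
begin

text \<open>
  RHBS on \<open>N\<close> gaps costs \<open>\<lceil>lg N\<rceil>\<close> or one less, the cheap gaps being the leftmost ones. A random pair
  inserted into \<open>n - 2\<close> sorted elements therefore costs on average at most \<open>2 k + D p + O (1 / n)\<close>, where
  \<open>n = p 2\<^sup>k\<close> with \<open>1 / 2 < p \<le> 1\<close>. For two RHBS insertions \<open>D p = 2 - 2 / p\<close>; for 2Merge, round
  \<open>r\<close> catches the smaller element with probability about \<open>2 ^ (- r)\<close>, the costs of rounds of equal parity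
  form a geometric series, and \<open>D\<close> is a quadratic polynomial in \<open>1 / p\<close> on each of three intervals.
  As \<open>D\<close> is increasing in \<open>p\<close>, these bounds are dominated by the increments of
  \<open>k n - 2\<^sup>k + 2\<^sup>k P p\<close> with \<open>P' = D / 2\<close> and \<open>P 1 \<le> 2 P (1 / 2)\<close>. The constant comes from
  \<open>P p \<le> p lg p - 1.40118 p + 1\<close> on \<open>[1 / 2, 1]\<close>, which is tightest near \<open>p = 0.8983\<close>, where about
  \<open>3e-7\<close> is left.
\<close>

section \<open>Right-heavy binary search\<close>

text \<open>The probes of 2Merge sit at floors of irrational multiples of \<open>n\<close>, so block
  lengths and numbers of cheap gaps differ by bounded amounts from ideal values. Gaps caught in
  round \<open>r\<close> have weight at most about \<open>n / 2 powr (r / 2)\<close>, so its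
  deviation costs a multiple of that. These errors sum geometrically to \<open>O (n)\<close>, and
  dividing by the \<open>n (n - 1)\<close> ordered pairs leaves \<open>O (1 / n)\<close> per step,
  hence \<open>O (lg n)\<close> in total.

  Two rounds halve the ideal block length exactly, so rounds of equal parity occupy the same place
  between consecutive powers of two. Each parity crosses a power of two at one value of
  \<open>p\<close>; these two values separate the three intervals.

  The condition \<open>P 1 \<le> 2 P (1 / 2)\<close> concerns \<open>n = 2 ^ k\<close>, where the
  potential can be read with exponent \<open>k\<close> and \<open>p = 1\<close>, or with
  \<open>k + 1\<close> and \<open>p = 1 / 2\<close>. Together with \<open>P' = D / 2\<close> it
  governs the additive constant: equality means that \<open>P (1 / 2)\<close> is half the integral
  of \<open>D\<close> over \<open>[1 / 2, 1]\<close>.\<close>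

lemma clg_le_iff: "0 < N \<Longrightarrow> clg (real N) \<le> k \<longleftrightarrow> N \<le> 2 ^ k"
proof -
  assume N: "0 < N"
  have "clg (real N) \<le> k \<longleftrightarrow> log 2 (real N) \<le> real k"
    unfolding clg_def by (simp add: nat_le_iff ceiling_le_iff)
  also have "\<dots> \<longleftrightarrow> real N \<le> 2 powr real k"
    using N by (simp add: log_le_iff)
  also have "\<dots> \<longleftrightarrow> real N \<le> real (2 ^ k)" by (simp add: powr_realpow)
  also have "\<dots> \<longleftrightarrow> N \<le> 2 ^ k" by (simp only: of_nat_le_iff)
  finally show ?thesis .
qed

lemma le_two_power_clg: "0 < N \<Longrightarrow> N \<le> 2 ^ clg (real N)"
  using clg_le_iff[of N "clg (real N)"] by simp

lemma less_clg_iff: "0 < N \<Longrightarrow> k < clg (real N) \<longleftrightarrow> 2 ^ k < N"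
  using clg_le_iff[of N k] by linarith

lemma clg_eqI: "2 ^ k < N \<Longrightarrow> N \<le> 2 ^ Suc k \<Longrightarrow> clg (real N) = Suc k"
  using clg_le_iff[of N "Suc k"] less_clg_iff[of N k] by linarith

lemma clg_one [simp]: "clg 1 = 0"
  by (simp add: clg_def)

lemma clg_two_power: "clg (real (2 ^ k)) = k"
proof (cases k)
  case (Suc j)
  then show ?thesis using clg_eqI[of j "2 ^ k"] by simp
qed (simp add: clg_def)

text \<open>The test says \<open>g < 2 ^ clg (real N) - N\<close> without truncated subtraction. It
  fails for \<open>N = 1\<close>, so the outer difference never truncates.\<close>

definition gap_cost :: "nat \<Rightarrow> nat \<Rightarrow> nat" where
  "gap_cost g N = clg (real N) - (if g + N < 2 ^ clg (real N) then 1 else 0)"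

text \<open>External path length of a binary tree whose \<open>N\<close> leaves lie on two adjacent
  levels: with \<open>k = clg (real N)\<close> it is \<open>N k - (2 ^ k - N)\<close>.\<close>

definition total_gap_cost :: "nat \<Rightarrow> real" where
  "total_gap_cost N = real N * (real (clg (real N)) + 1) - 2 ^ clg (real N)"

text \<open>Raising the exponent by one already pays for the discount, so any larger
  \<open>K\<close> is allowed too. This is needed because rounding can shrink a block to half the
  power of two that its ideal length suggests, or less.\<close>

lemma gap_cost_le:
  assumes "g < N" "N \<le> 2 ^ K"
  shows "int (gap_cost g N) \<le> int K - (if g + N < 2 ^ K then 1 else 0)"
proof -
  have N: "0 < N" using assms by simp
  have le: "clg (real N) \<le> K" using clg_le_iff[OF N] assms by simp
  show ?thesis
  proof (cases "clg (real N) = K")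
    case True
    have "K \<noteq> 0" if "g + N < 2 ^ K" using that N by (cases K) auto
    then show ?thesis unfolding gap_cost_def True by auto
  next
    case False
    then have "clg (real N) \<le> K - 1" "1 \<le> K" using le by auto
    then show ?thesis unfolding gap_cost_def by auto
  qed
qed

lemma sum_gap_cost:
  assumes N: "0 < N"
  shows "(\<Sum>g<N. real (gap_cost g N)) = total_gap_cost N"
proof -
  define k where "k = clg (real N)"
  have le: "N \<le> 2 ^ k" unfolding k_def by (rule le_two_power_clg[OF N])
  \<comment> \<open>Guarantees that all \<open>2 ^ k - N\<close> cheap positions are below
    \<open>N\<close>.\<close>
  have half: "2 ^ k \<le> 2 * N"
  proof (cases k)
    case (Suc j)
    then show ?thesis using less_clg_iff[OF N, of j] unfolding k_def[symmetric] by simp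
  qed (use N in simp)
  have kpos: "1 \<le> k" if "g + N < 2 ^ k" for g using that N by (cases k) auto
  have "(\<Sum>g<N. real (gap_cost g N)) = (\<Sum>g<N. real k - (if g + N < 2 ^ k then 1 else 0))"
    by (intro sum.cong refl) (use kpos in \<open>auto simp: gap_cost_def k_def[symmetric] of_nat_diff\<close>)
  also have "\<dots> = real N * real k - (\<Sum>g<N. if g + N < 2 ^ k then 1 else 0)"
    by (simp add: sum_subtractf)
  also have "(\<Sum>g<N. if g + N < 2 ^ k then 1 else (0::real)) = real (card {g\<in>{..<N}. g + N < 2 ^ k})"
    by (simp add: sum.If_cases Int_def)
  also have "{g\<in>{..<N}. g + N < 2 ^ k} = {..<2 ^ k - N}" using half by auto
  finally show ?thesis using le
    by (simp add: total_gap_cost_def k_def[symmetric] of_nat_diff algebra_simps)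
qed

lemma gap_cost_one [simp]: "gap_cost g (Suc 0) = 0"
  by (simp add: gap_cost_def)

text \<open>One side of the pivot is always a complete tree. With \<open>N\<close> gaps and exponent
  \<open>k\<close>, if \<open>N \<le> 3 * 2 ^ (k - 2)\<close> the left side has
  \<open>2 ^ (k - 2)\<close> gaps, all cheap; otherwise the right side has
  \<open>2 ^ (k - 1)\<close> gaps, none cheap. The other side has exponent \<open>k - 1\<close> and
  inherits the remaining cheap gaps, again leftmost.\<close>

lemma rhbs_aux_eq:
  assumes "length T \<le> f" "sorted T" "a \<notin> set T"
  shows "rhbs_aux f a T = (card {j. j < length T \<and> T ! j < a},
           gap_cost (card {j. j < length T \<and> T ! j < a}) (Suc (length T)))"
  using assms
proof (induction f arbitrary: T)
  case 0
  then show ?case by simp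
next
  case (Suc f)
  show ?case
  proof (cases "T = []")
    case True
    then show ?thesis by simp
  next
    case False
    define i where "i = length T"
    have i: "0 < i" using False by (simp add: i_def)
    define N where "N = Suc i"
    define k where "k = clg (real N)"
    have N2: "2 \<le> N" using i by (simp add: N_def)
    have Nle: "N \<le> 2 ^ k" unfolding k_def by (rule le_two_power_clg) (simp add: N_def)
    have k1: "1 \<le> k" using Nle N2 by (cases k) auto
    define h where "h = (2::nat) ^ (k - 1)"
    have h: "2 ^ k = 2 * h" unfolding h_def using k1 by (cases k) auto
    have hN: "h < N" using less_clg_iff[of N "k - 1"] k1 N2 unfolding h_def k_def by auto
    define d where "d = rhbs_pivot i"
    define g where "g = card {j. j < length T \<and> T ! j < a}"
    have d: "d = (if 2 \<le> k \<and> N \<le> 3 * 2 ^ (k - 2) then 2 ^ (k - 2) else N - h)"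
      unfolding d_def rhbs_pivot_def Let_def N_def h_def k_def by simp
    have q: "h = 2 * 2 ^ (k - 2)" if "2 \<le> k"
    proof -
      have "k - 1 = Suc (k - 2)" using that by simp
      then show ?thesis unfolding h_def by (simp only: power_Suc)
    qed
    have d1: "1 \<le> d" using hN unfolding d by auto
    have di: "d \<le> i"
    proof (cases "2 \<le> k \<and> N \<le> 3 * 2 ^ (k - 2)")
      case True
      then show ?thesis using q hN d by (simp add: N_def)
    next
      case False
      then have "d = N - h" by (simp only: d if_False)
      moreover have "0 < h" by (simp add: h_def)
      ultimately show ?thesis by (simp add: N_def)
    qed
    have lenle: "length T \<le> Suc f" by fact
    have sorted: "sorted T" and nin: "a \<notin> set T" by fact+
    have nth: "T ! j \<noteq> a" if "j < i" for j using that nin i_def by auto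
    have mono: "T ! j \<le> T ! j'" if "j \<le> j'" "j' < i" for j j'
      using sorted_nth_mono[OF sorted] that i_def by auto
    show ?thesis
    proof (cases "a < T ! (d - 1)")
      case True
      have eq: "{j. j < length (take (d - 1) T) \<and> take (d - 1) T ! j < a} = {j. j < length T \<and> T ! j < a}"
      proof -
        have "j < d - 1" if "j < i" "T ! j < a" for j
        proof (rule ccontr)
          assume "\<not> j < d - 1"
          then have "T ! (d - 1) \<le> T ! j" using mono[of "d - 1" j] that by simp
          with that True show False by simp
        qed
        then show ?thesis using di by (auto simp: i_def)
      qed
      have sub: "{j. j < length T \<and> T ! j < a} \<subseteq> {..<d - 1}"
        unfolding eq[symmetric] using di d1 by auto
      have gd: "g < d" using card_mono[OF _ sub] d1 unfolding g_def by auto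
      have "rhbs_aux f a (take (d - 1) T) = (g, gap_cost g d)"
      proof -
        have "length (take (d - 1) T) \<le> f" using lenle di d1 by (simp add: i_def)
        moreover have "sorted (take (d - 1) T)" using sorted by (rule sorted_wrt_take)
        moreover have "a \<notin> set (take (d - 1) T)" using nin in_set_takeD by fast
        moreover have "Suc (length (take (d - 1) T)) = d" using di d1 by (simp add: i_def)
        ultimately show ?thesis using Suc.IH[of "take (d - 1) T"] unfolding eq g_def[symmetric] by simp
      qed
      then have *: "rhbs_aux (Suc f) a T = (g, gap_cost g d + 1)"
        using False True d_def i_def by simp
      have "gap_cost g N = gap_cost g d + 1"
      proof (cases "2 \<le> k \<and> N \<le> 3 * 2 ^ (k - 2)")
        case T1: True
        then have dd: "d = 2 ^ (k - 2)" by (simp add: d)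
        have "gap_cost g d = k - 2" using clg_two_power[of "k - 2"] by (simp add: gap_cost_def dd)
        moreover have "g + N < 2 ^ k" using gd h q T1 dd by auto
        then have "gap_cost g N = k - 1" by (simp add: gap_cost_def k_def[symmetric])
        ultimately show ?thesis using T1 by linarith
      next
        case F1: False
        then have dd: "d = N - h" by (simp only: d if_False)
        have cd: "clg (real d) = k - 1"
        proof (cases "2 \<le> k")
          case T2: True
          have "2 ^ (k - 2) < d" using F1 T2 q dd by simp
          moreover have "d \<le> 2 ^ Suc (k - 2)" using dd Nle h q T2 by simp
          ultimately show ?thesis using clg_eqI T2 by fastforce
        next
          case False
          then have "k = 1" using k1 by simp
          then have "d = 1" using dd Nle N2 h by (simp add: h_def)
          then show ?thesis using \<open>k = 1\<close> by simp
        qed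
        have "2 ^ (k - 1) = h" by (simp add: h_def)
        moreover have "g + d < h \<longleftrightarrow> g + N < 2 ^ k" using dd hN h by auto
        moreover have "h \<noteq> 1" if "g + d < h" using that d1 by auto
        moreover have "2 \<le> k" if "h \<noteq> 1" using that unfolding h_def by (cases "k = 1") (use k1 in auto)
        ultimately show ?thesis unfolding gap_cost_def cd k_def[symmetric] using k1
          by (auto simp: Suc_diff_le)
      qed
      with * show ?thesis unfolding g_def[symmetric]
        unfolding i_def[symmetric] N_def[symmetric] by (simp only:)
    next
      case F: False
      have low: "T ! j < a" if "j < d" for j
      proof -
        have "T ! j \<le> T ! (d - 1)" using mono[of j "d - 1"] that di by simp
        moreover have "d - 1 < i" using di d1 by linarith
        then have "T ! (d - 1) < a" using F nth[of "d - 1"] by (metis linorder_neqE)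
        ultimately show ?thesis by simp
      qed
      define B where "B = {j. j < length (drop d T) \<and> drop d T ! j < a}"
      have eq: "{j. j < length T \<and> T ! j < a} = {..<d} \<union> (\<lambda>j. d + j) ` B"
      proof (intro equalityI subsetI)
        fix j assume j: "j \<in> {j. j < length T \<and> T ! j < a}"
        show "j \<in> {..<d} \<union> (\<lambda>j. d + j) ` B"
        proof (cases "j < d")
          case False
          then have "j = d + (j - d)" "j - d \<in> B" using j by (auto simp: B_def)
          then show ?thesis by blast
        qed simp
      qed (use low di in \<open>auto simp: B_def i_def\<close>)
      have finB: "finite B" by (simp add: B_def)
      have g: "g = d + card B"
      proof -
        have "card ((\<lambda>j. d + j) ` B) = card B" by (rule card_image) (simp add: inj_on_def)
        then show ?thesis unfolding g_def eq by (subst card_Un_disjoint) (use finB in auto)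
      qed
      have "card B \<le> card {..<length (drop d T)}" by (rule card_mono) (auto simp: B_def)
      then have cB: "card B \<le> i - d" by (simp add: i_def)
      have "rhbs_aux f a (drop d T) = (card B, gap_cost (card B) (N - d))"
      proof -
        have "length (drop d T) \<le> f" using lenle di d1 by (simp add: i_def)
        moreover have "sorted (drop d T)" using sorted by (rule sorted_wrt_drop)
        moreover have "a \<notin> set (drop d T)" using nin in_set_dropD by fast
        moreover have "Suc (length (drop d T)) = N - d" using di d1 by (simp add: i_def N_def)
        ultimately show ?thesis using Suc.IH[of "drop d T"] unfolding B_def[symmetric] by simp
      qed
      then have *: "rhbs_aux (Suc f) a T = (g, gap_cost (card B) (N - d) + 1)"
        using False F d_def i_def g by (simp add: Let_def)
      have "gap_cost g N = gap_cost (card B) (N - d) + 1"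
      proof (cases "2 \<le> k \<and> N \<le> 3 * 2 ^ (k - 2)")
        case T1: True
        then have dd: "d = 2 ^ (k - 2)" by (simp add: d)
        have cd: "clg (real (N - d)) = k - 1"
        proof -
          have "2 ^ (k - 2) < N - d" using dd hN q T1 by simp
          moreover have "N - d \<le> 2 ^ Suc (k - 2)" unfolding power_Suc dd using T1 by linarith
          ultimately have "clg (real (N - d)) = Suc (k - 2)" by (rule clg_eqI)
          moreover have "Suc (k - 2) = k - 1" using T1 by linarith
          ultimately show ?thesis by (simp only:)
        qed
        have "2 ^ (k - 1) = h" by (simp add: h_def)
        moreover have "h = 2 * d" using q T1 dd by simp
        then have "card B + (N - d) < h \<longleftrightarrow> g + N < 2 ^ k" unfolding h g using hN by auto
        ultimately show ?thesis unfolding gap_cost_def cd k_def[symmetric] using T1 by auto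
      next
        case F1: False
        then have dd: "d = N - h" by (simp only: d if_False)
        then have "N - d = h" using hN by simp
        then have "gap_cost (card B) (N - d) = k - 1"
          using clg_two_power[of "k - 1"] by (simp add: gap_cost_def h_def)
        moreover have "\<not> g + N < 2 ^ k"
        proof (cases "2 \<le> k")
          case True
          then show ?thesis using F1 q h g dd hN by auto
        next
          case False
          then have "h = 1" using k1 by (simp add: h_def)
          then show ?thesis using N2 h by simp
        qed
        then have "gap_cost g N = k" by (simp add: gap_cost_def k_def[symmetric])
        ultimately show ?thesis using k1 by simp
      qed
      with * show ?thesis unfolding g_def[symmetric]
        unfolding i_def[symmetric] N_def[symmetric] by (simp only:)
    qed
  qed
qed

text \<open>Between powers of two the summand is linear, so the sum is quadratic in
  \<open>i\<close>. The exponent is that of \<open>i\<close>, not of the last summand; at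
  \<open>i = 2 ^ k + 1\<close> the formulas with exponents \<open>k\<close> and \<open>k + 1\<close>
  agree. The \<open>1 / 3\<close> makes the empty sum at \<open>i = 1\<close> vanish.\<close>

lemma sum_total_gap_cost:
  assumes "0 < i"
  shows "(\<Sum>N=1..<i. total_gap_cost N) =
    (real (clg (real i)) + 1) * (real i * (real i - 1) / 2) - real i * 2 ^ clg (real i)
      + 4 ^ clg (real i) / 6 + 2 ^ clg (real i) / 2 + 1 / 3"
  using assms
proof (induction i rule: nat_induct_non_zero)
  case 1
  then show ?case by simp
next
  case (Suc n)
  define k where "k = clg (real n)"
  have nle: "n \<le> 2 ^ k" unfolding k_def by (rule le_two_power_clg) fact
  have S: "(\<Sum>N=1..<Suc n. total_gap_cost N) = (\<Sum>N=1..<n. total_gap_cost N) + total_gap_cost n"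
    using Suc.hyps by simp
  have t: "total_gap_cost n = real n * (real k + 1) - 2 ^ k"
    by (simp add: total_gap_cost_def k_def)
  show ?case
  proof (cases "n = 2 ^ k")
    case True
    have "clg (real (Suc n)) = Suc k" by (rule clg_eqI) (use True in auto)
    moreover have "real n = 2 ^ k" using True by simp
    moreover have "(4::real) ^ k = 2 ^ k * 2 ^ k" by (simp add: power_mult_distrib[symmetric])
    ultimately show ?thesis unfolding S Suc.IH t k_def[symmetric]
      by (simp add: field_simps)
  next
    case False
    have "clg (real (Suc n)) = k"
    proof (cases k)
      case 0
      then show ?thesis using nle False Suc.hyps by simp
    next
      case (Suc j)
      have "2 ^ j < n" using less_clg_iff[of n j] Suc.hyps Suc k_def by simp
      then show ?thesis using clg_eqI[of j "Suc n"] False nle Suc by simp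
    qed
    then show ?thesis unfolding S Suc.IH t k_def[symmetric]
      by (simp add: field_simps)
  qed
qed

section \<open>The cost of 2Merge\<close>

lemma card_nth_less_le: "card {j. j < length T \<and> T ! j < a} \<le> length T"
proof -
  have "card {j. j < length T \<and> T ! j < a} \<le> card {..<length T}" by (rule card_mono) auto
  then show ?thesis by simp
qed

lemma nth_less_iff_less_card:
  assumes "sorted T" "j < length T"
  shows "T ! j < a \<longleftrightarrow> j < card {j. j < length T \<and> T ! j < a}"
proof -
  define A where "A = {j. j < length T \<and> T ! j < a}"
  have fin: "finite A" by (simp add: A_def)
  have down: "j' \<in> A" if "j \<in> A" "j' \<le> j" for j j'
    using that sorted_nth_mono[OF assms(1), of j' j] unfolding A_def by auto
  have "j \<in> A \<longleftrightarrow> j < card A"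
  proof
    assume "j \<in> A"
    then have "{..j} \<subseteq> A" using down by auto
    from card_mono[OF fin this] show "j < card A" by simp
  next
    assume lt: "j < card A"
    show "j \<in> A"
    proof (rule ccontr)
      assume "j \<notin> A"
      then have "A \<subseteq> {..<j}" using down by (meson lessThan_iff linorder_not_less subsetI)
      from card_mono[OF _ this] lt show False by simp
    qed
  qed
  then show ?thesis using assms(2) by (simp add: A_def)
qed

lemma card_nth_less_segment:
  assumes "sorted T" "lo + n \<le> length T"
    and "lo \<le> card {j. j < length T \<and> T ! j < a}"
    and "card {j. j < length T \<and> T ! j < a} \<le> lo + n"
  shows "card {j. j < length (take n (drop lo T)) \<and> take n (drop lo T) ! j < a} =
    card {j. j < length T \<and> T ! j < a} - lo"
proof -
  define l where "l = card {j. j < length T \<and> T ! j < a}"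
  have "{j. j < length (take n (drop lo T)) \<and> take n (drop lo T) ! j < a} = {..<l - lo}"
    using assms nth_less_iff_less_card[OF assms(1), of _ a] unfolding l_def[symmetric] by auto
  then show ?thesis by (simp add: l_def)
qed

lemma rhbs_eq:
  assumes "sorted T" "a \<notin> set T"
  shows "rhbs a T = (card {j. j < length T \<and> T ! j < a},
    gap_cost (card {j. j < length T \<and> T ! j < a}) (Suc (length T)))"
  unfolding rhbs_def by (rule rhbs_aux_eq) (use assms in auto)

lemma rhbs_segment:
  assumes "sorted T" "a \<notin> set T" "lo + n \<le> length T"
    and "lo \<le> card {j. j < length T \<and> T ! j < a}"
    and "card {j. j < length T \<and> T ! j < a} \<le> lo + n"
  shows "rhbs a (take n (drop lo T)) = (card {j. j < length T \<and> T ! j < a} - lo,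
    gap_cost (card {j. j < length T \<and> T ! j < a} - lo) (Suc n))"
proof -
  have "a \<notin> set (take n (drop lo T))" using assms(2) in_set_takeD in_set_dropD by fast
  moreover have "sorted (take n (drop lo T))" using assms(1) by (simp add: sorted_wrt_take sorted_wrt_drop)
  ultimately have "rhbs a (take n (drop lo T)) =
     (card {j. j < length (take n (drop lo T)) \<and> take n (drop lo T) ! j < a},
      gap_cost (card {j. j < length (take n (drop lo T)) \<and> take n (drop lo T) ! j < a})
      (Suc (length (take n (drop lo T)))))" by (intro rhbs_eq)
  moreover have "length (take n (drop lo T)) = n" using assms(3) by simp
  ultimately show ?thesis unfolding card_nth_less_segment[OF assms(1,3,4,5)] by (simp only:)
qed

text \<open>\<open>block_bound i r\<close> is the number of gaps of \<open>T\<close> to the right of the element probed in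
  round \<open>r\<close> (all gaps for \<open>r = 0\<close>), so that round \<open>r\<close> catches the gaps \<open>l\<close> with
  \<open>block_bound i r < i - 1 - l \<le> block_bound i (r - 1)\<close>.\<close>

definition block_bound :: "nat \<Rightarrow> nat \<Rightarrow> nat" where
  "block_bound i r = nat \<lfloor>2 powr (- real r / 2) * real i\<rfloor> - 1"

text \<open>If the smaller element lies in gap \<open>l\<close>, then \<open>j = i - 1 - l\<close>
  gaps remain for the larger one. Indexing by \<open>j\<close> makes the index also the weight in
  the later sums.\<close>

definition stop_round :: "nat \<Rightarrow> nat \<Rightarrow> nat" where
  "stop_round i j = (LEAST r. block_bound i r < j)"

lemma alpha_idx_eq: "alpha_idx r i = i - nat \<lfloor>2 powr (- real r / 2) * real i\<rfloor>"
proof -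
  define x where "x = 2 powr (- real r / 2) * real i"
  have "2 powr (- real r / 2) \<le> 2 powr (0::real)" by (intro powr_mono) auto
  then have "2 powr (- real r / 2) \<le> (1::real)" by simp
  then have x: "0 \<le> x" "x \<le> real i" by (auto simp: x_def mult_left_le_one_le)
  have "\<lceil>(1 - 2 powr (- real r / 2)) * real i\<rceil> = \<lceil>- x\<rceil> + int i"
    using ceiling_add_of_int[of "- x" "int i"] by (simp add: x_def algebra_simps)
  then have "alpha_idx r i = nat (int i - \<lfloor>x\<rfloor>)" unfolding alpha_idx_def by (simp add: ceiling_minus)
  then show ?thesis unfolding x_def[symmetric] using x by (simp add: nat_diff_distrib' )
qed

text \<open>The truncation in \<open>block_bound\<close> fits the convention for probes beyond the
  list: there the bound is 0, and every gap counts as lying left of the probe.\<close>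

lemma less_alpha_idx_iff:
  assumes "l + 2 \<le> i"
  shows "l < alpha_idx r i \<longleftrightarrow> block_bound i r < i - 1 - l"
  using assms unfolding alpha_idx_eq block_bound_def by auto

lemma alpha_idx_pos: "1 \<le> r \<Longrightarrow> 1 \<le> i \<Longrightarrow> 1 \<le> alpha_idx r i"
proof -
  assume r: "1 \<le> r" and i: "1 \<le> i"
  have "2 powr (- real r / 2) < 2 powr (0::real)" using r by (intro powr_less_mono) auto
  then have "0 < (1 - 2 powr (- real r / 2)) * real i" using i by simp
  then show ?thesis unfolding alpha_idx_def by linarith
qed

lemma block_bound_0 [simp]: "block_bound i 0 = i - 1"
  by (simp add: block_bound_def)

lemma block_bound_antimono: "r \<le> s \<Longrightarrow> block_bound i s \<le> block_bound i r"
  unfolding block_bound_def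
  by (intro diff_le_mono nat_mono floor_mono mult_right_mono) auto

text \<open>The last round exceeds \<open>2 lg i - 1\<close>, so fewer than \<open>sqrt 2\<close> of
  the \<open>i\<close> units remain and its probe lies beyond the list. Hence the scan always stops
  in time, and the case of exhausted rounds never arises.\<close>

lemma block_bound_merge_rounds:
  assumes "2 \<le> i"
  shows "block_bound i (merge_rounds i) = 0"
proof -
  define R where "R = merge_rounds i"
  have "0 \<le> log 2 (real i)" using assms by simp
  then have "2 * log 2 (real i) < real R + 1" unfolding R_def merge_rounds_def by linarith
  then have "log 2 (real i) < (real R + 1) / 2" by simp
  then have "real i < 2 powr ((real R + 1) / 2)"
    using assms log_less_iff[of 2 "real i" "(real R + 1) / 2"] by fastforce
  then have "2 powr (- real R / 2) * real i < 2 powr (- real R / 2) * 2 powr ((real R + 1) / 2)" by simp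
  also have "\<dots> = 2 powr (1 / 2)" by (simp add: powr_add[symmetric] field_simps)
  also have "\<dots> = sqrt 2" by (simp add: powr_half_sqrt)
  also have "\<dots> < 2" by (simp add: real_sqrt_less_iff sqrt2_less_2)
  finally show ?thesis unfolding block_bound_def R_def[symmetric] by linarith
qed

lemma stop_round:
  assumes "2 \<le> i" "0 < j" "j < i"
  shows "block_bound i (stop_round i j) < j" "1 \<le> stop_round i j" "stop_round i j \<le> merge_rounds i"
    "j \<le> block_bound i (stop_round i j - 1)" "s < stop_round i j \<Longrightarrow> j \<le> block_bound i s"
proof -
  have ex: "block_bound i (merge_rounds i) < j" using block_bound_merge_rounds assms by simp
  then show 1: "block_bound i (stop_round i j) < j" unfolding stop_round_def by (rule LeastI)
  show "stop_round i j \<le> merge_rounds i" unfolding stop_round_def using ex by (rule Least_le)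
  show 3: "j \<le> block_bound i s" if "s < stop_round i j" for s
    using not_less_Least[of s "\<lambda>r. block_bound i r < j"] that unfolding stop_round_def by simp
  have "stop_round i j \<noteq> 0" using 1 assms by (intro notI) auto
  then show "1 \<le> stop_round i j" "j \<le> block_bound i (stop_round i j - 1)" using 3 by auto
qed

lemma stop_round_eqI:
  assumes "block_bound i (Suc r) < j" "j \<le> block_bound i r"
  shows "stop_round i j = Suc r"
  unfolding stop_round_def
proof (rule Least_equality)
  show "Suc r \<le> s" if "block_bound i s < j" for s
  proof (rule ccontr)
    assume "\<not> Suc r \<le> s"
    then have "block_bound i r \<le> block_bound i s" by (intro block_bound_antimono) simp
    then show False using that assms by simp
  qed
qed (use assms in simp)

text \<open>The number of comparisons is only bounded, because stopping at a probe beyond the list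
  is free.\<close>

lemma scan_eq:
  assumes "sorted T" "a \<notin> set T" "1 \<le> i" "1 \<le> r" "r \<le> r'" "r' < r + k"
    and "card {j. j < length T \<and> T ! j < a} < alpha_idx r' i"
    and "\<And>s. r \<le> s \<Longrightarrow> s < r' \<Longrightarrow> alpha_idx s i \<le> card {j. j < length T \<and> T ! j < a}"
  shows "\<exists>c \<le> r' - r + 1. scan k a T i r = (r', c)"
  using assms(4-)
proof (induction k arbitrary: r)
  case 0
  then show ?case by simp
next
  case (Suc k)
  define l where "l = card {j. j < length T \<and> T ! j < a}"
  have l: "l \<le> length T" unfolding l_def by (rule card_nth_less_le)
  have pos: "1 \<le> alpha_idx r i" by (rule alpha_idx_pos) (use assms Suc in auto)
  have cmp: "a < T ! (alpha_idx r i - 1) \<longleftrightarrow> l < alpha_idx r i" if "alpha_idx r i \<le> length T"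
  proof -
    have lt: "alpha_idx r i - 1 < length T" using that pos by linarith
    have "T ! (alpha_idx r i - 1) \<noteq> a" using lt assms(2) by auto
    then have "a < T ! (alpha_idx r i - 1) \<longleftrightarrow> \<not> T ! (alpha_idx r i - 1) < a" by auto
    also have "\<dots> \<longleftrightarrow> \<not> alpha_idx r i - 1 < l"
      unfolding l_def using nth_less_iff_less_card[OF assms(1) lt] by simp
    also have "\<dots> \<longleftrightarrow> l < alpha_idx r i" using pos by linarith
    finally show ?thesis .
  qed
  show ?case
  proof (cases "r = r'")
    case True
    then have "l < alpha_idx r i" using Suc.prems l_def by simp
    then show ?thesis using True cmp by (auto simp: Let_def)
  next
    case False
    then have nl: "\<not> l < alpha_idx r i" using Suc.prems(5)[of r] Suc.prems(2) l_def by simp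
    have "\<exists>c \<le> r' - (r + 1) + 1. scan k a T i (r + 1) = (r', c)"
      by (rule Suc.IH) (use Suc.prems False in auto)
    then obtain c where c: "c \<le> r' - (r + 1) + 1" "scan k a T i (r + 1) = (r', c)" by blast
    have "scan (Suc k) a T i r = (r', c + 1)" using nl l cmp c(2) by (auto simp: Let_def)
    moreover have "c + 1 \<le> r' - r + 1" using c(1) False Suc.prems(2) by linarith
    ultimately show ?thesis by blast
  qed
qed

text \<open>Counted from the right, the block of round \<open>r\<close> runs from
  \<open>block_bound i r + 1\<close> to \<open>block_bound i (r - 1)\<close>; subtracting
  \<open>j\<close> from its upper end gives the position from the left, which
  \<open>gap_cost\<close> expects. The last search has \<open>j\<close> gaps, with
  \<open>m - l\<close> of them to the left of \<open>b\<close>.\<close>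

lemma merge2_cost_le:
  fixes a b :: "'a::linorder"
  assumes T: "sorted T" "a \<notin> set T" "b \<notin> set T" and ab: "min a0 b0 = a" "max a0 b0 = b"
    and i: "i = length T + 2"
    and l: "l = card {j. j < length T \<and> T ! j < a}"
    and m: "m = card {j. j < length T \<and> T ! j < b}"
    and j: "j = i - 1 - l" and r: "r = stop_round i j"
  shows "merge2_cost a0 b0 T \<le> 1 + r
    + gap_cost (block_bound i (r - 1) - j) (block_bound i (r - 1) - block_bound i r) + gap_cost (m - l) j"
proof -
  have "a \<le> b" unfolding ab[symmetric] by (rule order_trans[OF min.cobounded1 max.cobounded1])
  then have "{j. j < length T \<and> T ! j < a} \<subseteq> {j. j < length T \<and> T ! j < b}" by auto
  then have lm: "l \<le> m" unfolding l m by (intro card_mono) auto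
  have ll: "l \<le> length T" unfolding l by (rule card_nth_less_le)
  have mm: "m \<le> length T" unfolding m by (rule card_nth_less_le)
  have j0: "0 < j" "j < i" using j ll i by auto
  have i2: "2 \<le> i" using i by simp
  note sr = stop_round[OF i2 j0, folded r]
  define R where "R = merge_rounds i"
  have "\<exists>c \<le> r - 1 + 1. scan R a T i 1 = (r, c)"
  proof (rule scan_eq[OF T(1,2)])
    show "r < 1 + R" using sr(3) R_def by simp
    show "card {j. j < length T \<and> T ! j < a} < alpha_idx r i"
      unfolding l[symmetric] using less_alpha_idx_iff[of l i r] ll i sr(1) j by simp
    fix s assume "1 \<le> s" "s < r"
    then show "alpha_idx s i \<le> card {j. j < length T \<and> T ! j < a}"
      unfolding l[symmetric] using less_alpha_idx_iff[of l i s] ll i sr(5)[of s] j by simp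
  qed (use i2 sr in auto)
  then obtain c where c: "c \<le> r" "scan R a T i 1 = (r, c)" using sr(2) by auto
  define u where "u = block_bound i (r - 1)"
  define v where "v = block_bound i r"
  have uv: "v < j" "j \<le> u" using sr u_def v_def by auto
  have lo: "alpha_idx (r - 1) i = i - 1 - u"
  proof -
    have "0 < u" using uv by simp
    then show ?thesis unfolding u_def alpha_idx_eq block_bound_def by linarith
  qed
  have ui: "u \<le> i - 1" unfolding u_def using block_bound_antimono[of 0 "r - 1" i] by simp
  \<comment> \<open>The minimum takes effect when the floor is 0: the index \<open>i - 1\<close> is
    then cut to \<open>i - 2\<close>, in accordance with \<open>v = 0\<close>.\<close>
  have hi: "min (alpha_idx r i - 1) (length T) = i - 2 - v"
    unfolding v_def alpha_idx_eq block_bound_def using i by linarith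
  define n where "n = u - v - 1"
  have n: "(i - 2 - v) - (i - 1 - u) = n" unfolding n_def using uv ui by linarith
  have "rhbs a (take n (drop (i - 1 - u) T)) = (l - (i - 1 - u), gap_cost (l - (i - 1 - u)) (Suc n))"
  proof -
    have "(i - 1 - u) + n \<le> length T" "i - 1 - u \<le> l" "l \<le> (i - 1 - u) + n"
      using uv ui n_def i j ll by linarith+
    then show ?thesis unfolding l by (intro rhbs_segment[OF T(1,2)])
  qed
  moreover have "l - (i - 1 - u) = u - j" using uv ui i j ll by linarith
  moreover have "Suc n = u - v" unfolding n_def using uv by linarith
  ultimately have R1: "rhbs a (take n (drop (i - 1 - u) T)) = (u - j, gap_cost (u - j) (u - v))" by simp
  have lp: "(i - 1 - u) + (u - j) = l" using uv ui i j ll by linarith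
  have "rhbs b (take (j - 1) (drop l T)) = (m - l, gap_cost (m - l) (Suc (j - 1)))"
  proof -
    have "l + (j - 1) \<le> length T" "l \<le> m" "m \<le> l + (j - 1)" using lm i j ll mm by linarith+
    then show ?thesis unfolding m by (intro rhbs_segment[OF T(1,3)])
  qed
  moreover have "take (j - 1) (drop l T) = drop l T" using i j by simp
  ultimately have R2: "rhbs b (drop l T) = (m - l, gap_cost (m - l) j)" using j0 by simp
  have "merge2_cost a0 b0 T = 1 + c + gap_cost (u - j) (u - v) + gap_cost (m - l) j"
    unfolding merge2_cost_def Let_def ab i[symmetric] R_def[symmetric] c(2) case_prod_conv
    unfolding lo hi n R1 using sr(3) R1 R2 lp n hi by (simp add: R_def)
  then show ?thesis using c(1) u_def v_def by simp
qed

section \<open>Summation over permutations\<close>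

lemma sum_permutations_of_set_snoc:
  assumes "finite S" "S \<noteq> {}"
  shows "(\<Sum>xs\<in>permutations_of_set S. f xs) =
    (\<Sum>y\<in>S. \<Sum>xs\<in>permutations_of_set (S - {y}). f (xs @ [y]))"
proof -
  have eq: "permutations_of_set S = (\<Union>y\<in>S. (\<lambda>xs. xs @ [y]) ` permutations_of_set (S - {y}))"
  proof (intro equalityI subsetI)
    fix xs assume xs: "xs \<in> permutations_of_set S"
    then have x: "set xs = S" "distinct xs" by (auto dest: permutations_of_setD)
    then have "xs \<noteq> []" using assms by auto
    then obtain ys y where ys: "xs = ys @ [y]" by (metis append_butlast_last_id)
    then have "y \<in> S" "ys \<in> permutations_of_set (S - {y})"
      using x by (auto intro!: permutations_of_setI)
    then show "xs \<in> (\<Union>y\<in>S. (\<lambda>xs. xs @ [y]) ` permutations_of_set (S - {y}))" using ys by blast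
  next
    fix xs assume "xs \<in> (\<Union>y\<in>S. (\<lambda>xs. xs @ [y]) ` permutations_of_set (S - {y}))"
    then obtain y ys where "y \<in> S" "ys \<in> permutations_of_set (S - {y})" "xs = ys @ [y]" by blast
    moreover from this have "set ys = S - {y}" "distinct ys" by (auto dest: permutations_of_setD)
    ultimately show "xs \<in> permutations_of_set S"
      by (intro permutations_of_setI) auto
  qed
  have "(\<Sum>xs\<in>permutations_of_set S. f xs) =
      (\<Sum>y\<in>S. \<Sum>xs\<in>(\<lambda>xs. xs @ [y]) ` permutations_of_set (S - {y}). f xs)"
    unfolding eq by (rule sum.UNION_disjoint) (use assms in auto)
  also have "\<dots> = (\<Sum>y\<in>S. \<Sum>xs\<in>permutations_of_set (S - {y}). f (xs @ [y]))"
    by (rule sum.cong[OF refl], subst sum.reindex) (auto simp: inj_on_def)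
  finally show ?thesis .
qed

definition pair_cost :: "'a::linorder \<Rightarrow> 'a \<Rightarrow> 'a list \<Rightarrow> nat" where
  "pair_cost x y T =
     (if 0.5511 \<le> p_of (real (length T + 2)) \<and> p_of (real (length T + 2)) \<le> 0.888
      then merge2_cost x y T else snd (rhbs x T) + snd (rhbs y (insort x T)))"

declare ins12_cost.simps [simp del]

lemma ins12_cost_snoc2:
  assumes "xs \<noteq> []"
  shows "ins12_cost (xs @ [x, y]) = ins12_cost xs + pair_cost x y (sort xs)"
proof -
  have "\<not> length (xs @ [x, y]) \<le> 2" using assms by simp
  then show ?thesis
    by (subst ins12_cost.simps)
      (simp add: Let_def pair_cost_def nth_append)
qed

lemma sort_permutation: "xs \<in> permutations_of_set S \<Longrightarrow> sort xs = sorted_list_of_set S"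
  using sorted_list_of_set_sort_remdups[of xs] permutations_of_setD[of xs S]
  by (simp add: distinct_remdups_id)

text \<open>The last two entries form an ordered pair of distinct elements, and the sorted prefix
  depends only on the remaining set, so the arrangements of the prefix factor out. Arbitrary finite
  \<open>S\<close> is needed since these prefixes range over subsets. \<open>B\<close> only has to
  be a supersolution of the recursion whose step average is bounded by \<open>u\<close>.\<close>

lemma sum_ins12_cost_le:
  fixes S :: "'a::linorder set" and B u :: "nat \<Rightarrow> real"
  assumes B2: "1 \<le> B 2"
    and Bstep: "\<And>n. even n \<Longrightarrow> 4 \<le> n \<Longrightarrow> B (n - 2) + u n \<le> B n"
    and pairs: "\<And>S::'a set. finite S \<Longrightarrow> even (card S) \<Longrightarrow> 4 \<le> card S \<Longrightarrow>
      (\<Sum>y\<in>S. \<Sum>x\<in>S - {y}. real (pair_cost x y (sorted_list_of_set (S - {y} - {x}))))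
        \<le> real (card S) * (real (card S) - 1) * u (card S)"
  shows "finite S \<Longrightarrow> even (card S) \<Longrightarrow> 2 \<le> card S \<Longrightarrow>
    (\<Sum>xs\<in>permutations_of_set S. real (ins12_cost xs)) \<le> fact (card S) * B (card S)"
proof (induction "card S" arbitrary: S rule: less_induct)
  case less
  note fin = \<open>finite S\<close>
  define n where "n = card S"
  show ?case
  proof (cases "n = 2")
    case True
    have "(\<Sum>xs\<in>permutations_of_set S. real (ins12_cost xs)) = (\<Sum>xs\<in>permutations_of_set S. 1)"
      by (intro sum.cong refl, subst ins12_cost.simps)
        (use True n_def fin in \<open>auto simp: length_finite_permutations_of_set\<close>)
    also have "\<dots> = fact n" using fin by (simp add: n_def)
    finally show ?thesis using B2 True by (simp add: n_def)
  next
    case False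
    then have n4: "4 \<le> n" "even n" using less.prems n_def by (auto elim!: evenE)
    have "(\<Sum>xs\<in>permutations_of_set S. real (ins12_cost xs)) =
      (\<Sum>y\<in>S. \<Sum>x\<in>S - {y}. \<Sum>xs\<in>permutations_of_set (S - {y} - {x}). real (ins12_cost (xs @ [x, y])))"
    proof (subst sum_permutations_of_set_snoc, goal_cases)
      case 3
      have ne: "S - {y} \<noteq> {}" if "y \<in> S" for y
      proof
        assume "S - {y} = {}"
        then have "S \<subseteq> {y}" by auto
        then have "card S \<le> 1" using card_mono[of "{y}" S] by simp
        then show False using n4 n_def by simp
      qed
      show ?case
        by (intro sum.cong refl, subst sum_permutations_of_set_snoc)
          (use fin ne in \<open>auto\<close>)
    qed (use fin n4 n_def in auto)
    also have "\<dots> \<le> (\<Sum>y\<in>S. \<Sum>x\<in>S - {y}. fact (n - 2) * B (n - 2) +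
        fact (n - 2) * real (pair_cost x y (sorted_list_of_set (S - {y} - {x}))))"
    proof (intro sum_mono)
      fix y x assume y: "y \<in> S" and x: "x \<in> S - {y}"
      define A where "A = S - {y} - {x}"
      have finA: "finite A" using fin by (simp add: A_def)
      have cA: "card A = n - 2" using x y fin n4 by (simp add: A_def n_def)
      have "real (ins12_cost (xs @ [x, y])) = real (ins12_cost xs) + real (pair_cost x y (sorted_list_of_set A))"
        if "xs \<in> permutations_of_set A" for xs
      proof -
        have "length xs = n - 2" using that length_finite_permutations_of_set cA by metis
        then have "xs \<noteq> []" using n4 by auto
        then show ?thesis unfolding ins12_cost_snoc2[OF \<open>xs \<noteq> []\<close>] sort_permutation[OF that] by simp
      qed
      then have "(\<Sum>xs\<in>permutations_of_set A. real (ins12_cost (xs @ [x, y]))) =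
        (\<Sum>xs\<in>permutations_of_set A. real (ins12_cost xs)) + fact (n - 2) * real (pair_cost x y (sorted_list_of_set A))"
        using finA cA by (simp add: sum.distrib)
      moreover have "(\<Sum>xs\<in>permutations_of_set A. real (ins12_cost xs)) \<le> fact (n - 2) * B (n - 2)"
        using less.hyps[of A] finA cA n4 n_def by simp
      ultimately show "(\<Sum>xs\<in>permutations_of_set (S - {y} - {x}). real (ins12_cost (xs @ [x, y]))) \<le>
        fact (n - 2) * B (n - 2) + fact (n - 2) * real (pair_cost x y (sorted_list_of_set (S - {y} - {x})))"
        unfolding A_def by linarith
    qed
    also have "\<dots> = real n * (real n - 1) * fact (n - 2) * B (n - 2) + fact (n - 2) *
      (\<Sum>y\<in>S. \<Sum>x\<in>S - {y}. real (pair_cost x y (sorted_list_of_set (S - {y} - {x}))))"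
    proof -
      have "(\<Sum>y\<in>S. \<Sum>x\<in>S - {y}. fact (n - 2) * B (n - 2)) = (\<Sum>y\<in>S. (real n - 1) * (fact (n - 2) * B (n - 2)))"
        using fin n4 by (intro sum.cong refl) (simp add: n_def of_nat_diff)
      then show ?thesis by (simp add: sum.distrib sum_distrib_left n_def)
    qed
    also have "\<dots> \<le> real n * (real n - 1) * fact (n - 2) * B (n - 2) + fact (n - 2) *
      (real n * (real n - 1) * u n)"
      using pairs[of S] fin n4 unfolding n_def by (intro add_left_mono mult_left_mono) auto
    also have "\<dots> = real n * (real n - 1) * fact (n - 2) * (B (n - 2) + u n)"
      by (simp add: algebra_simps)
    also have "\<dots> \<le> real n * (real n - 1) * fact (n - 2) * B n"
      using Bstep[of n] n4 by (intro mult_left_mono) auto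
    also have "real n * (real n - 1) * fact (n - 2) = fact n"
    proof -
      have "n = Suc (Suc (n - 2))" using n4 by simp
      then obtain q where "n = Suc (Suc q)" by blast
      then show ?thesis by simp
    qed
    finally show ?thesis by (simp only: n_def)
  qed
qed

text \<open>Ranks enumerate \<open>{..<card A}\<close> bijectively; this turns uniformly random
  elements into uniformly random gaps.\<close>

lemma sum_rank:
  fixes A :: "'a::linorder set"
  assumes "finite A"
  shows "(\<Sum>x\<in>A. f (card {w\<in>A. w < x})) = (\<Sum>g<card A. f g)"
proof (rule sum.reindex_bij_betw)
  let ?\<rho> = "\<lambda>x. card {w\<in>A. w < x}"
  have less: "?\<rho> x < ?\<rho> y" if "x \<in> A" "x < y" for x y
    by (rule psubset_card_mono) (use assms that in auto)
  have "inj_on ?\<rho> A"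
  proof (rule inj_onI)
    fix x y assume "x \<in> A" "y \<in> A" "?\<rho> x = ?\<rho> y"
    then show "x = y" using less[of x y] less[of y x] by (cases x y rule: linorder_cases) auto
  qed
  moreover have "?\<rho> ` A \<subseteq> {..<card A}"
  proof (rule image_subsetI)
    fix x assume "x \<in> A"
    then show "?\<rho> x \<in> {..<card A}" using assms by (auto intro!: psubset_card_mono)
  qed
  ultimately have "?\<rho> ` A = {..<card A}"
    by (intro card_subset_eq) (auto simp: card_image)
  then show "bij_betw ?\<rho> A {..<card A}"
    using \<open>inj_on ?\<rho> A\<close> by (simp add: bij_betw_def)
qed

lemma card_nth_less_sorted_list_of_set:
  assumes "finite A"
  shows "card {j. j < length (sorted_list_of_set A) \<and> sorted_list_of_set A ! j < a} = card {w\<in>A. w < a}"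
proof -
  let ?T = "sorted_list_of_set A"
  have "bij_betw (\<lambda>j. ?T ! j) {j. j < length ?T \<and> ?T ! j < a} {w\<in>A. w < a}"
  proof (rule bij_betwI')
    fix x y assume "x \<in> {j. j < length ?T \<and> ?T ! j < a}" "y \<in> {j. j < length ?T \<and> ?T ! j < a}"
    then show "(?T ! x = ?T ! y) = (x = y)" by (simp add: nth_eq_iff_index_eq)
  next
    fix x assume "x \<in> {j. j < length ?T \<and> ?T ! j < a}"
    then show "?T ! x \<in> {w\<in>A. w < a}"
      using nth_mem[of x ?T] assms by (simp del: nth_mem)
  next
    fix y assume "y \<in> {w\<in>A. w < a}"
    then have "y \<in> set ?T" "y < a" using assms by auto
    then show "\<exists>x\<in>{j. j < length ?T \<and> ?T ! j < a}. y = ?T ! x"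
      by (auto simp: in_set_conv_nth)
  qed
  then show ?thesis by (rule bij_betw_same_card)
qed

lemma rhbs_sorted_list_of_set:
  assumes "finite A" "a \<notin> A"
  shows "snd (rhbs a (sorted_list_of_set A)) = gap_cost (card {w\<in>A. w < a}) (Suc (card A))"
  using rhbs_eq[of "sorted_list_of_set A" a] card_nth_less_sorted_list_of_set[of A a] assms
  by simp

text \<open>For fixed \<open>y\<close> the rank of \<open>x\<close> still runs through all
  \<open>n - 1\<close> gaps, while the cost of inserting \<open>y\<close> does not depend on
  \<open>x\<close>.\<close>

lemma sum_rhbs_pairs:
  fixes S :: "'a::linorder set"
  assumes "finite S" "2 \<le> card S"
  shows "(\<Sum>y\<in>S. \<Sum>x\<in>S - {y}. real (snd (rhbs x (sorted_list_of_set (S - {y} - {x}))) +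
      snd (rhbs y (insort x (sorted_list_of_set (S - {y} - {x})))))) =
    real (card S) * total_gap_cost (card S - 1) + (real (card S) - 1) * total_gap_cost (card S)"
proof -
  define n where "n = card S"
  have n: "2 \<le> n" using assms n_def by simp
  have inner: "(\<Sum>x\<in>S - {y}. real (snd (rhbs x (sorted_list_of_set (S - {y} - {x}))) +
      snd (rhbs y (insort x (sorted_list_of_set (S - {y} - {x})))))) =
      total_gap_cost (n - 1) + (real n - 1) * real (gap_cost (card {w\<in>S. w < y}) n)" if y: "y \<in> S" for y
  proof -
    define A where "A = S - {y}"
    have finA: "finite A" and cA: "card A = n - 1" and yA: "y \<notin> A"
      using assms y by (auto simp: A_def n_def)
    have ry: "{w\<in>A. w < y} = {w\<in>S. w < y}" unfolding A_def by auto
    have "snd (rhbs x (sorted_list_of_set (A - {x}))) + snd (rhbs y (insort x (sorted_list_of_set (A - {x}))))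
      = gap_cost (card {w\<in>A. w < x}) (n - 1) + gap_cost (card {w\<in>S. w < y}) n" if x: "x \<in> A" for x
    proof -
      have "insort x (sorted_list_of_set (A - {x})) = sorted_list_of_set A"
        using finA x by (simp add: sorted_list_of_set.fold_insort_key.remove)
      moreover have "{w \<in> A - {x}. w < x} = {w\<in>A. w < x}" by auto
      moreover have "Suc (card (A - {x})) = n - 1" "Suc (card A) = n"
        using finA x cA n card_Suc_Diff1[OF finA x] by auto
      ultimately show ?thesis
        using rhbs_sorted_list_of_set[of "A - {x}" x] rhbs_sorted_list_of_set[of A y] finA yA ry by simp
    qed
    then have "(\<Sum>x\<in>A. real (snd (rhbs x (sorted_list_of_set (A - {x}))) +
        snd (rhbs y (insort x (sorted_list_of_set (A - {x})))))) =
        (\<Sum>x\<in>A. real (gap_cost (card {w\<in>A. w < x}) (n - 1)) + real (gap_cost (card {w\<in>S. w < y}) n))"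
      by (intro sum.cong refl) simp
    also have "\<dots> = (\<Sum>g<n - 1. real (gap_cost g (n - 1))) + real (n - 1) * real (gap_cost (card {w\<in>S. w < y}) n)"
      using sum_rank[OF finA, of "\<lambda>g. real (gap_cost g (n - 1))"] cA by (simp add: sum.distrib)
    finally show ?thesis unfolding A_def using sum_gap_cost[of "n - 1"] n by (simp add: of_nat_diff)
  qed
  have "(\<Sum>y\<in>S. total_gap_cost (n - 1) + (real n - 1) * real (gap_cost (card {w\<in>S. w < y}) n)) =
    real n * total_gap_cost (n - 1) + (real n - 1) * (\<Sum>g<n. real (gap_cost g n))"
    using sum_rank[OF assms(1), of "\<lambda>g. real (gap_cost g n)"]
    by (simp add: sum.distrib sum_distrib_left[symmetric] n_def)
  then show ?thesis using inner sum_gap_cost[of n] n by (simp add: n_def)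
qed

text \<open>Accounts for placing the smaller element only; the comparison within the pair and the
  search for the larger element are counted separately.\<close>

definition first_cost :: "nat \<Rightarrow> nat \<Rightarrow> nat" where
  "first_cost i j = stop_round i j + gap_cost (block_bound i (stop_round i j - 1) - j)
     (block_bound i (stop_round i j - 1) - block_bound i (stop_round i j))"

text \<open>\<open>\<Phi>\<close> takes gaps of the list without the pair. Removing the smaller
  element lowers the rank of the larger one, hence \<open>max g h - 1\<close>. The factor 2 accounts
  for the two orders of each pair.\<close>

lemma sum_ordered_pairs:
  fixes \<Phi> :: "nat \<Rightarrow> nat \<Rightarrow> real"
  shows "(\<Sum>g<n. \<Sum>h\<in>{..<n} - {g}. \<Phi> (min g h) (max g h - 1)) =
    2 * (\<Sum>l<n - 1. \<Sum>m=l..<n - 1. \<Phi> l m)"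
proof -
  have A: "(\<Sum>l<n. \<Sum>h\<in>{l<..<n}. \<Phi> l (h - 1)) = (\<Sum>l<n - 1. \<Sum>m=l..<n - 1. \<Phi> l m)"
  proof (cases n)
    case (Suc q)
    have "(\<Sum>h\<in>{l<..<n}. \<Phi> l (h - 1)) = (\<Sum>m=l..<n - 1. \<Phi> l m)" for l
      by (rule sum.reindex_bij_witness[of _ Suc "\<lambda>h. h - 1"]) auto
    then show ?thesis using Suc by simp
  qed simp
  have "(\<Sum>g<n. \<Sum>h\<in>{..<n} - {g}. \<Phi> (min g h) (max g h - 1)) =
     (\<Sum>g<n. (\<Sum>h<g. \<Phi> h (g - 1)) + (\<Sum>h\<in>{g<..<n}. \<Phi> g (h - 1)))"
  proof (intro sum.cong refl)
    fix g assume g: "g \<in> {..<n}"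
    have eq: "{..<n} - {g} = {..<g} \<union> {g<..<n}" using g by auto
    have "(\<Sum>h\<in>{..<n} - {g}. \<Phi> (min g h) (max g h - 1)) =
      (\<Sum>h<g. \<Phi> (min g h) (max g h - 1)) + (\<Sum>h\<in>{g<..<n}. \<Phi> (min g h) (max g h - 1))"
      unfolding eq by (rule sum.union_disjoint) auto
    also have "\<dots> = (\<Sum>h<g. \<Phi> h (g - 1)) + (\<Sum>h\<in>{g<..<n}. \<Phi> g (h - 1))"
      by (intro arg_cong2[where f = "(+)"] sum.cong refl) (auto simp: min_def max_def)
    finally show "(\<Sum>h\<in>{..<n} - {g}. \<Phi> (min g h) (max g h - 1)) = \<dots>" .
  qed
  also have "\<dots> = (\<Sum>g<n. \<Sum>h<g. \<Phi> h (g - 1)) + (\<Sum>g<n. \<Sum>h\<in>{g<..<n}. \<Phi> g (h - 1))"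
    by (rule sum.distrib)
  also have "(\<Sum>g<n. \<Sum>h<g. \<Phi> h (g - 1)) = (\<Sum>l<n. \<Sum>h\<in>{l<..<n}. \<Phi> l (h - 1))"
  proof -
    have "(\<Sum>g<n. \<Sum>h<g. \<Phi> h (g - 1)) = (\<Sum>g<n. \<Sum>h<n. if h < g then \<Phi> h (g - 1) else 0)"
      by (intro sum.cong refl sum.mono_neutral_cong_left) auto
    also have "\<dots> = (\<Sum>h<n. \<Sum>g<n. if h < g then \<Phi> h (g - 1) else 0)" by (rule sum.swap)
    also have "\<dots> = (\<Sum>l<n. \<Sum>h\<in>{l<..<n}. \<Phi> l (h - 1))"
      by (intro sum.cong refl sum.mono_neutral_cong_right) auto
    finally show ?thesis .
  qed
  finally show ?thesis using A by simp
qed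

text \<open>A smaller element in gap \<open>l\<close> admits \<open>j = n - 1 - l\<close> gaps for
  the larger one. So its own cost gets weight \<open>j\<close>, and the searches for the larger one
  run once over all \<open>j\<close> gaps.\<close>

lemma sum_merge2_pairs_le:
  fixes S :: "'a::linorder set"
  assumes fin: "finite S" and n: "n = card S" "2 \<le> n"
  shows "(\<Sum>y\<in>S. \<Sum>x\<in>S - {y}. real (merge2_cost x y (sorted_list_of_set (S - {y} - {x})))) \<le>
    2 * (\<Sum>j=1..<n. real j * (1 + real (first_cost n j)) + total_gap_cost j)"
proof -
  define \<rho> where "\<rho> x = card {w\<in>S. w < x}" for x
  define \<Phi> where "\<Phi> l m = 1 + real (first_cost n (n - 1 - l)) + real (gap_cost (m - l) (n - 1 - l))" for l m
  have le: "real (merge2_cost x y (sorted_list_of_set (S - {y} - {x}))) \<le> \<Phi> (min (\<rho> x) (\<rho> y)) (max (\<rho> x) (\<rho> y) - 1)"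
    if "x \<in> S" "y \<in> S" "x \<noteq> y" for x y
  proof -
    define a where "a = min x y"
    define b where "b = max x y"
    have ab: "a < b" "{a, b} = {x, y}" "a \<in> S" "b \<in> S"
      using that by (auto simp: a_def b_def min_def max_def)
    define A where "A = S - {y} - {x}"
    have A: "A = S - {a, b}" unfolding A_def ab(2) by auto
    have finA: "finite A" and cA: "card A = n - 2"
      using fin n that by (auto simp: A_def)
    have ra: "card {w\<in>A. w < a} = \<rho> a"
      unfolding \<rho>_def A using ab(1) by (intro arg_cong[where f = card]) auto
    have "{w\<in>S. w < b} = insert a {w\<in>A. w < b}" unfolding A using ab by auto
    moreover have "a \<notin> {w\<in>A. w < b}" by (simp add: A)
    ultimately have rb: "card {w\<in>A. w < b} = \<rho> b - 1" unfolding \<rho>_def using finA by simp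
    have "\<rho> a \<le> \<rho> b" unfolding \<rho>_def using fin ab(1) by (intro card_mono) auto
    then have mm: "min (\<rho> x) (\<rho> y) = \<rho> a" "max (\<rho> x) (\<rho> y) = \<rho> b"
      using ab(2) by (auto simp: a_def b_def min_def max_def split: if_splits)
    have len: "length (sorted_list_of_set A) + 2 = n" using finA cA n by simp
    have "merge2_cost x y (sorted_list_of_set A) \<le> 1 + stop_round n (n - 1 - \<rho> a) +
       gap_cost (block_bound n (stop_round n (n - 1 - \<rho> a) - 1) - (n - 1 - \<rho> a))
        (block_bound n (stop_round n (n - 1 - \<rho> a) - 1) - block_bound n (stop_round n (n - 1 - \<rho> a)))
       + gap_cost (\<rho> b - 1 - \<rho> a) (n - 1 - \<rho> a)"
      by (rule merge2_cost_le[where a = a and b = b and l = "\<rho> a" and m = "\<rho> b - 1"])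
        (simp_all only: card_nth_less_sorted_list_of_set[OF finA] ra rb len a_def[symmetric]
          b_def[symmetric] set_sorted_list_of_set[OF finA] sorted_sorted_list_of_set, simp_all add: A)
    then have "real (merge2_cost x y (sorted_list_of_set A)) \<le> \<Phi> (\<rho> a) (\<rho> b - 1)"
      unfolding \<Phi>_def first_cost_def by linarith
    then show ?thesis unfolding mm A_def .
  qed
  have inj: "\<rho> x = \<rho> y \<longleftrightarrow> x = y" if "x \<in> S" "y \<in> S" for x y
  proof -
    have "\<rho> x < \<rho> y" if "x \<in> S" "x < y" for x y
      unfolding \<rho>_def by (rule psubset_card_mono) (use fin that in auto)
    from this[of x y] this[of y x] show ?thesis using that by (cases x y rule: linorder_cases) auto
  qed
  have "(\<Sum>y\<in>S. \<Sum>x\<in>S - {y}. real (merge2_cost x y (sorted_list_of_set (S - {y} - {x})))) \<le>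
    (\<Sum>y\<in>S. \<Sum>x\<in>S - {y}. \<Phi> (min (\<rho> x) (\<rho> y)) (max (\<rho> x) (\<rho> y) - 1))"
    using le by (intro sum_mono) auto
  also have "\<dots> = (\<Sum>y\<in>S. \<Sum>x\<in>S. if \<rho> x = \<rho> y then 0 else \<Phi> (min (\<rho> x) (\<rho> y)) (max (\<rho> x) (\<rho> y) - 1))"
    by (intro sum.cong refl sum.mono_neutral_cong_left) (use fin inj in auto)
  also have "\<dots> = (\<Sum>y\<in>S. \<Sum>h<n. if h = \<rho> y then 0 else \<Phi> (min h (\<rho> y)) (max h (\<rho> y) - 1))"
    unfolding \<rho>_def n
    by (intro sum.cong refl sum_rank[OF fin, of "\<lambda>h. if h = card {w \<in> S. w < y} then 0
      else \<Phi> (min h (card {w \<in> S. w < y})) (max h (card {w \<in> S. w < y}) - 1)" for y])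
  also have "\<dots> = (\<Sum>g<n. \<Sum>h<n. if h = g then 0 else \<Phi> (min h g) (max h g - 1))"
    unfolding \<rho>_def n
    by (rule sum_rank[OF fin, of "\<lambda>g. \<Sum>h<card S. if h = g then 0 else \<Phi> (min h g) (max h g - 1)"])
  also have "\<dots> = (\<Sum>g<n. \<Sum>h\<in>{..<n} - {g}. \<Phi> (min g h) (max g h - 1))"
    by (intro sum.cong refl sum.mono_neutral_cong_right) (auto simp: min.commute max.commute)
  also have "\<dots> = 2 * (\<Sum>l<n - 1. \<Sum>m=l..<n - 1. \<Phi> l m)" by (rule sum_ordered_pairs)
  also have "(\<Sum>l<n - 1. \<Sum>m=l..<n - 1. \<Phi> l m) =
    (\<Sum>l<n - 1. real (n - 1 - l) * (1 + real (first_cost n (n - 1 - l))) + total_gap_cost (n - 1 - l))"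
  proof (intro sum.cong refl)
    fix l assume l: "l \<in> {..<n - 1}"
    have "(\<Sum>m=l..<n - 1. real (gap_cost (m - l) (n - 1 - l))) = (\<Sum>g<n - 1 - l. real (gap_cost g (n - 1 - l)))"
      by (rule sum.reindex_bij_witness[of _ "\<lambda>g. g + l" "\<lambda>m. m - l"]) auto
    also have "\<dots> = total_gap_cost (n - 1 - l)" using l by (intro sum_gap_cost) auto
    finally show "(\<Sum>m=l..<n - 1. \<Phi> l m) =
        real (n - 1 - l) * (1 + real (first_cost n (n - 1 - l))) + total_gap_cost (n - 1 - l)"
      by (simp add: \<Phi>_def sum.distrib)
  qed
  also have "\<dots> = (\<Sum>j=1..<n. real j * (1 + real (first_cost n j)) + total_gap_cost j)"
    by (rule sum.reindex_bij_witness[of _ "\<lambda>j. n - 1 - j" "\<lambda>l. n - 1 - l"]) (simp_all, linarith)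
  finally show ?thesis .
qed

section \<open>The average cost of 2Merge\<close>

text \<open>The weight with exponent \<open>Suc r\<close> belongs to round \<open>Suc r\<close>.
  Thus \<open>a\<close> is the value at odd rounds, whose total weight in the limit is
  \<open>2 / 3\<close>.\<close>

lemma sum_alternating_geometric:
  fixes a b :: real
  shows "(\<Sum>r<R. (1 / 2) ^ Suc r * (if even r then a else b)) =
    (2 * a + b) / 3 - (1 / 2) ^ R * (if even R then (2 * a + b) / 3 else (2 * b + a) / 3)"
proof (induction R)
  case (Suc R)
  define y where "y = (1 / 2 :: real) ^ R"
  show ?case unfolding sum.lessThan_Suc Suc.IH unfolding power_Suc y_def[symmetric]
    by (cases "even R") (simp_all add: field_simps)
qed simp

text \<open>Moves the differences onto the costs \<open>c\<close>. Where their increments are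
  nonnegative, upper bounds on \<open>X\<close> suffice.\<close>

lemma abel_sum:
  fixes c X :: "nat \<Rightarrow> real"
  shows "(\<Sum>r<R. c (Suc r) * (X r - X (Suc r))) =
    c 1 * X 0 - c (Suc R) * X R + (\<Sum>r<R. X (Suc r) * (c (Suc (Suc r)) - c (Suc r)))"
  by (induction R) (auto simp: algebra_simps)

lemma sum_greaterThanAtMost_blocks:
  fixes v :: "nat \<Rightarrow> nat" and f :: "nat \<Rightarrow> real"
  assumes "\<And>r. v (Suc r) \<le> v r"
  shows "(\<Sum>j\<in>{v R<..v 0}. f j) = (\<Sum>r<R. \<Sum>j\<in>{v (Suc r)<..v r}. f j)"
proof (induction R)
  case (Suc R)
  have "v R \<le> v 0" by (rule lift_Suc_antimono_le) (use assms in auto)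
  then have "{v (Suc R)<..v 0} = {v R<..v 0} \<union> {v (Suc R)<..v R}" using assms[of R] by auto
  then have "(\<Sum>j\<in>{v (Suc R)<..v 0}. f j) = (\<Sum>j\<in>{v R<..v 0}. f j) + (\<Sum>j\<in>{v (Suc R)<..v R}. f j)"
    by (simp only:) (rule sum.union_disjoint, auto)
  then show ?case using Suc by simp
qed simp

lemma sum_greaterThanAtMost_real:
  assumes "m \<le> n"
  shows "(\<Sum>j\<in>{m<..n}. real j) = real n * (real n + 1) / 2 - real m * (real m + 1) / 2"
  using assms
proof (induction n rule: dec_induct)
  case (step n)
  then have "{m<..Suc n} = insert (Suc n) {m<..n}" by auto
  then show ?case using step by (simp add: field_simps)
qed simp

text \<open>Up to \<open>m / 2\<close>, the right side is the sum of the \<open>m\<close> largest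
  integers not above \<open>v\<close>. The left side has the ideal values \<open>S\<close> and
  \<open>V\<close> instead; a shortfall of 2 in either costs only a multiple of
  \<open>V\<close>.\<close>

lemma quadratic_lower_bound:
  fixes m v V S :: real
  assumes "0 \<le> m" "m \<le> v" "v \<le> V" "V - 2 \<le> v" "0 \<le> S" "S \<le> V" "S - 2 \<le> m"
  shows "S * V - S\<^sup>2 / 2 - 4 * V \<le> m * v - m\<^sup>2 / 2"
proof (cases "S \<le> m")
  case True
  have "0 \<le> (m - S) * (v - (m + S) / 2)" using True assms by (intro mult_nonneg_nonneg) auto
  moreover have "S * (V - 2) \<le> S * v" using assms by (intro mult_left_mono) auto
  ultimately show ?thesis using assms by (simp add: field_simps power2_eq_square)
next
  case False
  have "(S - m) * V \<le> 2 * V" using assms by (intro mult_right_mono) auto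
  moreover have "m * (V - v) \<le> m * 2" using assms by (intro mult_left_mono) auto
  moreover have "m\<^sup>2 \<le> S\<^sup>2" using False assms by (intro power_mono) auto
  ultimately show ?thesis using assms by (simp add: field_simps power2_eq_square)
qed

section \<open>Ideal block lengths and their rounding\<close>

definition sqrt2_m1 :: real ("\<delta>") where "\<delta> = sqrt 2 - 1"

lemma sqrt2_bounds: "1.4142135623 < sqrt 2" "sqrt 2 < 1.4142135624"
  by (rule real_less_rsqrt, simp add: power2_eq_square, rule real_less_lsqrt, simp_all add: power2_eq_square)

text \<open>Up to rounding, round \<open>r\<close> searches \<open>\<delta> * x r\<close> gaps, where \<open>x r = 2 powr (- r / 2) * i\<close>. The
  parameters \<open>e0\<close> (even \<open>r\<close>) and \<open>e1\<close> (odd \<open>r\<close>) encode the interval of \<open>p\<close>: the last four assumptions say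
  that \<open>K r\<close> is the exponent with \<open>2 powr K r / 2 \<le> \<delta> * x r \<le> 2 powr K r\<close>.\<close>

locale round_estimate =
  fixes i k e0 e1 :: nat and p t0 t1 :: real
  assumes i2: "2 \<le> i"
    and ip: "real i = p * 2 ^ k"
    and t0: "t0 = (1 / 2) ^ Suc e0" and t1: "t1 = sqrt 2 * (1 / 2) ^ Suc e1"
    and e: "e0 \<le> e1" "e1 \<le> Suc e0" "e1 \<le> 1"
    and z0: "\<delta> * p \<le> t0" "t0 \<le> 2 * \<delta> * p"
    and z1: "\<delta> * p \<le> t1" "t1 \<le> 2 * \<delta> * p"
begin

definition x :: "nat \<Rightarrow> real" where "x r = 2 powr (- real r / 2) * real i"

definition K :: "nat \<Rightarrow> int" where
  "K r = int k - int (r div 2) - 1 - (if even r then int e0 else int e1)"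

text \<open>\<open>\<tau> r / p\<close> is the ratio of \<open>2 powr K r\<close> to
  \<open>x r\<close>, which depends on the round only through its parity.\<close>

definition \<tau> :: "nat \<Rightarrow> real" where "\<tau> r = (if even r then t0 else t1)"

abbreviation v :: "nat \<Rightarrow> nat" where "v r \<equiv> block_bound i r"

abbreviation R :: nat where "R \<equiv> merge_rounds i"

lemma p_pos: "0 < p"
  using i2 ip by (metis of_nat_0_less_iff pos2 less_le_trans zero_less_mult_pos2 zero_less_power zero_less_numeral)

lemma x_pos: "0 < x r" using i2 by (simp add: x_def)

lemma x_Suc: "x r = sqrt 2 * x (Suc r)"
proof -
  have "- real r / 2 = 1 / 2 + - real (Suc r) / 2" by (simp add: field_simps)
  then have "2 powr (- real r / 2) = 2 powr (1 / 2) * 2 powr (- real (Suc r) / 2)"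
    by (metis powr_add)
  then show ?thesis by (simp add: x_def powr_half_sqrt)
qed

lemma x_Suc_le: "7 * x (Suc r) \<le> 5 * x r"
proof -
  have "7 / 5 * x (Suc r) \<le> sqrt 2 * x (Suc r)"
    using sqrt2_bounds x_pos[of "Suc r"] by (intro mult_right_mono) auto
  then show ?thesis unfolding x_Suc[of r] by linarith
qed

lemma x_diff: "x r - x (Suc r) = \<delta> * x (Suc r)"
  using x_Suc[of r] by (simp add: sqrt2_m1_def algebra_simps)

lemma x_0: "x 0 = real i" by (simp add: x_def)

lemma x_square: "(x r)\<^sup>2 = (1 / 2) ^ r * (real i)\<^sup>2"
proof (induction r)
  case (Suc r)
  then show ?case using x_Suc[of r] by (simp add: power_mult_distrib)
qed (simp add: x_0)

text \<open>Since \<open>sqrt 2\<close> exceeds \<open>7 / 5\<close>, each term is at most 4 times a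
  telescoping difference. This collects the rounding errors of all rounds.\<close>

lemma sum_x_le: "(\<Sum>r<n. x r) \<le> 4 * real i"
proof -
  have "x r \<le> 4 * (x r - x (Suc r))" for r
    using x_Suc_le[of r] x_pos[of r] by (simp add: algebra_simps)
  then have "(\<Sum>r<n. x r) \<le> (\<Sum>r<n. 4 * (x r - x (Suc r)))" by (intro sum_mono)
  also have "\<dots> = 4 * (x 0 - x n)" by (induction n) auto
  finally show ?thesis using x_pos[of n] by (simp add: x_0)
qed

lemma two_powr_K: "2 powr real_of_int (K r) = \<tau> r * x r / p"
proof -
  define q where "q = r div 2"
  have half: "2 powr (- real n) = (1 / 2) ^ n" for n
    by (simp add: powr_minus powr_realpow power_one_over inverse_eq_divide)
  have "x r / p = 2 powr (- real r / 2) * 2 ^ k" using ip p_pos by (simp add: x_def)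
  then have xp: "\<tau> r * x r / p = \<tau> r * (2 powr (- real r / 2) * 2 ^ k)"
    by (simp flip: times_divide_eq_right)
  show ?thesis
  proof (cases "even r")
    case True
    then have r: "r = 2 * q" by (simp add: q_def)
    have "real_of_int (K r) = real k + - real q + - real (Suc e0)" using True by (simp add: K_def q_def)
    then have "2 powr real_of_int (K r) = 2 ^ k * (1 / 2) ^ q * t0"
      unfolding t0 half[symmetric] by (simp only: powr_add powr_realpow zero_less_numeral)
    moreover have "2 powr (- real r / 2) = (1 / 2) ^ q" unfolding half[symmetric] r by simp
    ultimately show ?thesis unfolding xp using True by (simp add: \<tau>_def)
  next
    case False
    then have r: "r = 2 * q + 1" by (simp add: q_def)
    have "real_of_int (K r) = real k + - real q + - real (Suc e1)" using False by (simp add: K_def q_def)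
    then have "2 powr real_of_int (K r) = 2 ^ k * (1 / 2) ^ q * (1 / 2) ^ Suc e1"
      unfolding half[symmetric] by (simp only: powr_add powr_realpow zero_less_numeral)
    moreover have "- real r / 2 = - real q + - 1 / 2" by (simp add: r field_simps)
    then have "2 powr (- real r / 2) = (1 / 2) ^ q * 2 powr (- 1 / 2)"
      unfolding half[symmetric] by (metis powr_add)
    moreover have "sqrt 2 * 2 powr (- 1 / 2) = (1::real)"
      by (simp add: powr_half_sqrt[symmetric] powr_add[symmetric])
    moreover have "\<tau> r = t1" using False by (simp add: \<tau>_def)
    then have "\<tau> r = sqrt 2 * (1 / 2) ^ Suc e1" using t1 by (rule trans)
    ultimately have K: "2 powr real_of_int (K r) = 2 ^ k * (1 / 2) ^ q * (1 / 2) ^ Suc e1"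
      and r: "2 powr (- real r / 2) = (1 / 2) ^ q * 2 powr (- 1 / 2)"
      and s: "sqrt 2 * 2 powr (- 1 / 2) = (1::real)" and \<tau>: "\<tau> r = sqrt 2 * (1 / 2) ^ Suc e1"
      by blast+
    have "\<tau> r * (2 powr (- real r / 2) * 2 ^ k) =
      sqrt 2 * 2 powr (- 1 / 2) * (2 ^ k * (1 / 2) ^ q * (1 / 2) ^ Suc e1)"
      unfolding \<tau> r by (simp only: mult_ac)
    then show ?thesis unfolding xp K s by (simp only: mult_1_left)
  qed
qed

lemma ideal_le: "\<delta> * x r \<le> 2 powr real_of_int (K r)" "2 powr real_of_int (K r) \<le> 2 * (\<delta> * x r)"
proof -
  have "\<delta> * p \<le> \<tau> r" "\<tau> r \<le> 2 * \<delta> * p" using z0 z1 by (auto simp: \<tau>_def)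
  then have "\<delta> \<le> \<tau> r / p" "\<tau> r / p \<le> 2 * \<delta>" using p_pos by (auto simp: field_simps)
  then have "\<delta> * x r \<le> \<tau> r / p * x r" "\<tau> r / p * x r \<le> 2 * \<delta> * x r"
    using x_pos[of r] by (auto intro!: mult_right_mono simp del: times_divide_eq_left)
  then show "\<delta> * x r \<le> 2 powr real_of_int (K r)" "2 powr real_of_int (K r) \<le> 2 * (\<delta> * x r)"
    unfolding two_powr_K by auto
qed

lemma v_bounds: "real (v r) \<le> x r" "x r - 2 < real (v r)" "1 \<le> v r \<Longrightarrow> real (v r) \<le> x r - 1"
  using x_pos[of r] unfolding block_bound_def x_def[symmetric] by linarith+

lemma v_antimono: "v (Suc r) \<le> v r"
  by (rule block_bound_antimono) simp

lemma triangle_v_le: "real (v r) * (real (v r) + 1) / 2 \<le> (x r)\<^sup>2 / 2"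
proof (cases "v r = 0")
  case False
  then have "real (v r) * (real (v r) + 1) \<le> x r * x r"
    using v_bounds[of r] x_pos[of r] by (intro mult_mono) auto
  then show ?thesis by (simp add: power2_eq_square)
qed simp

text \<open>Differences of floors are off by less than 1. The further unit in the lower bound comes
  from the truncation in \<open>block_bound\<close> once \<open>x (Suc r) < 1\<close>.\<close>

lemma block_length:
  assumes "1 \<le> v r"
  shows "real (v r - v (Suc r)) < \<delta> * x (Suc r) + 1" "\<delta> * x (Suc r) - 2 < real (v r - v (Suc r))"
proof -
  have pos: "0 < x r" "0 < x (Suc r)" by (rule x_pos)+
  have d: "real (v r - v (Suc r)) = real (v r) - real (v (Suc r))" using v_antimono by (simp add: of_nat_diff)
  have vr: "real (v r) = real_of_int \<lfloor>x r\<rfloor> - 1" using assms pos unfolding block_bound_def x_def[symmetric] by linarith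
  have "v (Suc r) = 0 \<and> x (Suc r) < 1 \<or> real (v (Suc r)) = real_of_int \<lfloor>x (Suc r)\<rfloor> - 1"
    using pos unfolding block_bound_def x_def[symmetric] by linarith
  then show "real (v r - v (Suc r)) < \<delta> * x (Suc r) + 1" "\<delta> * x (Suc r) - 2 < real (v r - v (Suc r))"
    unfolding d vr x_diff[symmetric] using pos by linarith+
qed

text \<open>Blocks whose ideal exponent is negative are empty, so \<open>K\<close> never has to be truncated.\<close>

lemma K_nonneg:
  assumes "1 \<le> v r"
  shows "0 \<le> K (Suc r)"
proof (rule ccontr)
  assume "\<not> 0 \<le> K (Suc r)"
  then have "real_of_int (K (Suc r)) \<le> - 1" by linarith
  then have "2 powr real_of_int (K (Suc r)) \<le> 2 powr (- 1)" by (intro powr_mono) auto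
  then have "\<delta> * x (Suc r) \<le> 1 / 2" using ideal_le(1)[of "Suc r"] by (simp add: powr_minus)
  then have "x r - x (Suc r) \<le> 1 / 2" unfolding x_diff .
  moreover have "2 \<le> x r" using v_bounds(3)[OF assms] assms by linarith
  ultimately show False using x_Suc_le[of r] by linarith
qed

text \<open>Every gap is charged the round number plus the ideal exponent, less 1 if it is cheap.
  The cheap gaps are leftmost in the block and so carry its largest weights \<open>j\<close>;
  ideally there are \<open>2 powr K (Suc r) - \<delta> * x (Suc r)\<close> of them. The term
  \<open>4 * x r\<close> pays for rounding.\<close>

lemma block_cost_le:
  assumes "1 \<le> x r"
  shows "(\<Sum>j\<in>{v (Suc r)<..v r}. real j * (real (Suc r) + real (gap_cost (v r - j) (v r - v (Suc r)))))
    \<le> (real (Suc r) + real_of_int (K (Suc r))) *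
        (real (v r) * (real (v r) + 1) / 2 - real (v (Suc r)) * (real (v (Suc r)) + 1) / 2)
      - (2 powr real_of_int (K (Suc r)) - \<delta> * x (Suc r)) * x r
      + (2 powr real_of_int (K (Suc r)) - \<delta> * x (Suc r))\<^sup>2 / 2 + 4 * x r"
proof (cases "v r = 0")
  \<comment> \<open>The block is empty, but the ideal saving is not 0. As
    \<open>S \<le> x r < 2\<close>, the term \<open>4 * x r\<close> absorbs it.\<close>
  case True
  define S where "S = 2 powr real_of_int (K (Suc r)) - \<delta> * x (Suc r)"
  have S: "S \<le> \<delta> * x (Suc r)" using ideal_le(2)[of "Suc r"] by (simp add: S_def)
  have "S \<le> x r" using S x_diff[of r] x_pos[of "Suc r"] by linarith
  moreover have "x r < 2" using v_bounds(2)[of r] True by simp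
  ultimately have "S * x r \<le> 4 * x r" using assms by (intro mult_right_mono) auto
  moreover have "v (Suc r) = 0" using v_antimono[of r] True by simp
  moreover have "0 \<le> S\<^sup>2" by simp
  ultimately show ?thesis unfolding S_def[symmetric] using True by (simp, linarith)
next
  case False
  then have v1: "1 \<le> v r" by simp
  define S where "S = 2 powr real_of_int (K (Suc r)) - \<delta> * x (Suc r)"
  define N where "N = v r - v (Suc r)"
  define q where "q = nat (K (Suc r))"
  have Kq: "K (Suc r) = int q" using K_nonneg[OF v1] by (simp add: q_def)
  have pq: "2 powr real_of_int (K (Suc r)) = real (2 ^ q)" by (simp add: Kq powr_realpow)
  note N = block_length[OF v1, folded N_def]
  have Nq: "N \<le> 2 ^ q"
  proof -
    have "real N < real (2 ^ q) + 1" using N(1) ideal_le(1)[of "Suc r"] pq by linarith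
    then show ?thesis by linarith
  qed
  \<comment> \<open>Rounding can make \<open>N\<close> smaller than \<open>2 ^ q - N\<close>; then
    all \<open>N\<close> gaps are cheap, and no more.\<close>
  define m where "m = min (2 ^ q - N) N"
  have Nv: "N \<le> v r" by (simp add: N_def)
  have mS: "S - 2 \<le> real m"
  proof (cases "2 ^ q - N \<le> N")
    case True
    then have "real m = real (2 ^ q) - real N" using Nq by (simp add: m_def of_nat_diff)
    then show ?thesis using N(1) pq by (simp add: S_def)
  next
    case False
    then have "real m = real N" by (simp add: m_def)
    then show ?thesis using N(2) ideal_le(2)[of "Suc r"] by (simp add: S_def)
  qed
  have S: "0 \<le> S" "S \<le> x r"
    using ideal_le[of "Suc r"] x_diff[of r] x_pos[of "Suc r"] by (auto simp: S_def)
  have "(\<Sum>j\<in>{v (Suc r)<..v r}. real j * (real (Suc r) + real (gap_cost (v r - j) N)))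
    \<le> (\<Sum>j\<in>{v (Suc r)<..v r}. real j * (real (Suc r) + real q) - (if v r - j + N < 2 ^ q then real j else 0))"
  proof (intro sum_mono)
    fix j assume j: "j \<in> {v (Suc r)<..v r}"
    have "int (gap_cost (v r - j) N) \<le> int q - (if v r - j + N < 2 ^ q then 1 else 0)"
      by (rule gap_cost_le[OF _ Nq]) (use j N_def in auto)
    then have "real (gap_cost (v r - j) N) \<le> real q - (if v r - j + N < 2 ^ q then 1 else 0)"
      by (auto split: if_splits)
    then have "real j * (real (Suc r) + real (gap_cost (v r - j) N)) \<le>
      real j * (real (Suc r) + (real q - (if v r - j + N < 2 ^ q then 1 else 0)))"
      by (intro mult_left_mono) auto
    then show "real j * (real (Suc r) + real (gap_cost (v r - j) N)) \<le>
        real j * (real (Suc r) + real q) - (if v r - j + N < 2 ^ q then real j else 0)"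
      by (auto simp: algebra_simps split: if_splits)
  qed
  also have "\<dots> = (real (Suc r) + real q) * (\<Sum>j\<in>{v (Suc r)<..v r}. real j) -
      (\<Sum>j\<in>{v (Suc r)<..v r}. if v r - j + N < 2 ^ q then real j else 0)"
    by (simp add: sum_subtractf sum_distrib_left mult.commute)
  finally have A: "(\<Sum>j\<in>{v (Suc r)<..v r}. real j * (real (Suc r) + real (gap_cost (v r - j) N))) \<le> \<dots>" .
  have "S * x r - S\<^sup>2 / 2 - 4 * x r \<le> real m * real (v r) - (real m)\<^sup>2 / 2"
    by (rule quadratic_lower_bound) (use S mS v_bounds(1,2)[of r] Nv m_def in auto)
  also have "\<dots> \<le> (\<Sum>j\<in>{v r - m<..v r}. real j)"
  proof -
    have "m \<le> v r" using Nv by (simp add: m_def)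
    then show ?thesis
      by (subst sum_greaterThanAtMost_real) (auto simp: of_nat_diff field_simps power2_eq_square)
  qed
  also have "\<dots> = (\<Sum>j\<in>{v r - m<..v r}. if v r - j + N < 2 ^ q then real j else 0)"
    by (intro sum.cong refl) (auto simp: m_def)
  also have "\<dots> \<le> (\<Sum>j\<in>{v (Suc r)<..v r}. if v r - j + N < 2 ^ q then real j else 0)"
    by (rule sum_mono2) (auto simp: m_def N_def)
  finally have B: "S * x r - S\<^sup>2 / 2 - 4 * x r \<le> (\<Sum>j\<in>{v (Suc r)<..v r}. if v r - j + N < 2 ^ q then real j else 0)" .
  show ?thesis using A B
    unfolding sum_greaterThanAtMost_real[OF v_antimono] S_def[symmetric] N_def[symmetric]
    unfolding Kq of_int_of_nat_eq by linarith
qed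


lemma x_ge_1: "r \<le> R \<Longrightarrow> 1 \<le> x r"
proof -
  assume "r \<le> R"
  moreover have "real R \<le> 2 * log 2 (real i)"
    unfolding merge_rounds_def using i2 by (simp add: of_nat_floor)
  ultimately have "real r / 2 \<le> log 2 (real i)" by linarith
  then have "2 powr (real r / 2) \<le> real i" using i2 le_log_iff[of 2 "real i" "real r / 2"] by simp
  then show ?thesis unfolding x_def by (simp add: powr_minus field_simps)
qed

lemma x_R_le: "(x R)\<^sup>2 \<le> 4"
proof -
  have "x R < 2" using v_bounds(2)[of R] block_bound_merge_rounds[OF i2] by simp
  then have "(x R)\<^sup>2 \<le> 2\<^sup>2" using x_pos[of R] by (intro power_mono) auto
  then show ?thesis by simp
qed

text \<open>For \<open>S = x (Suc r) * s\<close> and \<open>x r = sqrt 2 * x (Suc r)\<close>, the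
  ideal saving \<open>S * x r - S^2 / 2\<close> equals
  \<open>(x (Suc r))^2 * h s / 2\<close>.\<close>

definition h :: "real \<Rightarrow> real" where "h s = 2 * sqrt 2 * s - s\<^sup>2"

lemma h_bounds:
  assumes "\<delta> * p \<le> t" "t \<le> 2 * \<delta> * p"
  shows "0 \<le> h (t / p - \<delta>)" "h (t / p - \<delta>) \<le> 2"
proof -
  define s where "s = t / p - \<delta>"
  have s: "0 \<le> s" "s \<le> \<delta>" using assms p_pos by (auto simp: s_def field_simps)
  have d: "\<delta> \<le> 0.5" "sqrt 2 \<le> 1.5" using sqrt2_bounds by (auto simp: sqrt2_m1_def)
  have "h s = s * (2 * sqrt 2 - s)" by (simp add: h_def power2_eq_square algebra_simps)
  moreover have "0 \<le> s * (2 * sqrt 2 - s)" using s d sqrt2_bounds by (intro mult_nonneg_nonneg) auto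
  moreover have "s * (2 * sqrt 2 - s) \<le> 0.5 * 3" using s d sqrt2_bounds by (intro mult_mono) auto
  ultimately show "0 \<le> h (t / p - \<delta>)" "h (t / p - \<delta>) \<le> 2" unfolding s_def[symmetric] by auto
qed

text \<open>Of the error \<open>19 * i\<close>, rounding inside the blocks takes
  \<open>16 * i\<close>, the cut-off tail of the series of savings \<open>2 * i\<close>, and
  replacing \<open>i^2\<close> by \<open>i * (i - 1)\<close> in the series of increments less than
  \<open>i\<close>.\<close>

lemma sum_first_cost_le:
  "(\<Sum>j=1..<i. real j * real (first_cost i j)) \<le> real i * (real i - 1) / 2 *
     (real k + 1 / 3 - (2 * real e1 + real e0) / 3 - (2 * h (t1 / p - \<delta>) + h (t0 / p - \<delta>)) / 3) + 19 * real i"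
proof -
  define X where "X r = real (v r) * (real (v r) + 1) / 2" for r
  define c where "c r = real r + real_of_int (K r)" for r
  define S where "S r = 2 powr real_of_int (K (Suc r)) - \<delta> * x (Suc r)" for r
  define h0 where "h0 = h (t0 / p - \<delta>)"
  define h1 where "h1 = h (t1 / p - \<delta>)"
  define I where "I = (real i)\<^sup>2 / 2"
  have vR: "v R = 0" by (rule block_bound_merge_rounds[OF i2])
  have "{1..<i} = {v R<..v 0}" using vR by auto
  then have "(\<Sum>j=1..<i. real j * real (first_cost i j)) = (\<Sum>j\<in>{v R<..v 0}. real j * real (first_cost i j))" by simp
  also have "\<dots> = (\<Sum>r<R. \<Sum>j\<in>{v (Suc r)<..v r}. real j * real (first_cost i j))"
    by (rule sum_greaterThanAtMost_blocks) (rule v_antimono)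
  also have "\<dots> = (\<Sum>r<R. \<Sum>j\<in>{v (Suc r)<..v r}. real j *
      (real (Suc r) + real (gap_cost (v r - j) (v r - v (Suc r)))))"
  proof (intro sum.cong refl)
    fix r j assume "j \<in> {v (Suc r)<..v r}"
    then have "stop_round i j = Suc r" by (intro stop_round_eqI) auto
    then show "real j * real (first_cost i j) =
        real j * (real (Suc r) + real (gap_cost (v r - j) (v r - v (Suc r))))"
      by (simp add: first_cost_def)
  qed
  also have "\<dots> \<le> (\<Sum>r<R. c (Suc r) * (X r - X (Suc r)) - S r * x r + (S r)\<^sup>2 / 2 + 4 * x r)"
    unfolding c_def X_def S_def by (intro sum_mono block_cost_le x_ge_1) auto
  also have "\<dots> = (\<Sum>r<R. c (Suc r) * (X r - X (Suc r))) - (\<Sum>r<R. S r * x r - (S r)\<^sup>2 / 2)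
      + 4 * (\<Sum>r<R. x r)"
    by (simp add: sum.distrib sum_subtractf sum_distrib_left)
  also have "(\<Sum>r<R. S r * x r - (S r)\<^sup>2 / 2) = I * (\<Sum>r<R. (1 / 2) ^ Suc r * (if even r then h1 else h0))"
    unfolding sum_distrib_left
  proof (intro sum.cong refl)
    fix r
    define s where "s = \<tau> (Suc r) / p - \<delta>"
    have Sr: "S r = x (Suc r) * s" unfolding S_def two_powr_K s_def by (simp add: algebra_simps)
    have "S r * x r - (S r)\<^sup>2 / 2 = (x (Suc r))\<^sup>2 * (h s / 2)"
      unfolding Sr x_Suc[of r] h_def by (simp add: power2_eq_square algebra_simps)
    also have "\<dots> = I * ((1 / 2) ^ Suc r * h s)" unfolding x_square I_def by simp
    also have "h s = (if even r then h1 else h0)" unfolding s_def h0_def h1_def \<tau>_def by simp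
    finally show "S r * x r - (S r)\<^sup>2 / 2 = I * ((1 / 2) ^ Suc r * (if even r then h1 else h0))" .
  qed
  also have "(\<Sum>r<R. (1 / 2) ^ Suc r * (if even r then h1 else h0)) =
    (2 * h1 + h0) / 3 - (1 / 2) ^ R * (if even R then (2 * h1 + h0) / 3 else (2 * h0 + h1) / 3)"
    by (rule sum_alternating_geometric)
  also have "(\<Sum>r<R. c (Suc r) * (X r - X (Suc r))) =
      c 1 * X 0 - c (Suc R) * X R + (\<Sum>r<R. X (Suc r) * (c (Suc (Suc r)) - c (Suc r)))"
    by (rule abel_sum)
  finally have main: "(\<Sum>j=1..<i. real j * real (first_cost i j)) \<le>
    c 1 * X 0 - c (Suc R) * X R + (\<Sum>r<R. X (Suc r) * (c (Suc (Suc r)) - c (Suc r))) -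
    I * ((2 * h1 + h0) / 3 - (1 / 2) ^ R * (if even R then (2 * h1 + h0) / 3 else (2 * h0 + h1) / 3))
    + 4 * (\<Sum>r<R. x r)" .
  define a where "a = real e1 - real e0"
  define b where "b = 1 + real e0 - real e1"
  have ab: "0 \<le> a" "0 \<le> b" "a \<le> 1" "b \<le> 1" using e by (auto simp: a_def b_def)
  have hb: "0 \<le> h0" "h0 \<le> 2" "0 \<le> h1" "h1 \<le> 2"
    unfolding h0_def h1_def by (rule h_bounds, fact z0, fact z0, rule h_bounds, fact z0, fact z0,
      rule h_bounds, fact z1, fact z1, rule h_bounds, fact z1, fact z1)
  \<comment> \<open>Over two rounds the round number grows by 2 and the exponent drops by 1, so
    \<open>a + b = 1\<close>; \<open>e0\<close> and \<open>e1\<close> decide which parity receives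
    the increment.\<close>
  have cd: "c (Suc (Suc r)) - c (Suc r) = (if even r then a else b)" for r
    by (auto simp: c_def K_def a_def b_def elim!: evenE oddE)
  have "(\<Sum>r<R. X (Suc r) * (c (Suc (Suc r)) - c (Suc r))) \<le>
    (\<Sum>r<R. I * ((1 / 2) ^ Suc r * (if even r then a else b)))"
  proof (intro sum_mono)
    fix r
    have "X (Suc r) \<le> I * (1 / 2) ^ Suc r"
      using triangle_v_le[of "Suc r"] unfolding X_def I_def x_square by (simp add: mult.commute)
    then have "X (Suc r) * (if even r then a else b) \<le> (I * (1 / 2) ^ Suc r) * (if even r then a else b)"
      using ab by (intro mult_right_mono) auto
    then show "X (Suc r) * (c (Suc (Suc r)) - c (Suc r)) \<le> I * ((1 / 2) ^ Suc r * (if even r then a else b))"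
      unfolding cd by (simp only: mult.assoc)
  qed
  also have "\<dots> = I * (\<Sum>r<R. (1 / 2) ^ Suc r * (if even r then a else b))"
    by (simp only: sum_distrib_left)
  also have "\<dots> \<le> I * ((2 * a + b) / 3)"
  proof (intro mult_left_mono)
    have "0 \<le> (1 / 2) ^ R * (if even R then (2 * a + b) / 3 else (2 * b + a) / 3)" using ab by simp
    then show "(\<Sum>r<R. (1 / 2) ^ Suc r * (if even r then a else b)) \<le> (2 * a + b) / 3"
      unfolding sum_alternating_geometric by linarith
  qed (simp add: I_def)
  finally have m1: "(\<Sum>r<R. X (Suc r) * (c (Suc (Suc r)) - c (Suc r))) \<le> I * ((2 * a + b) / 3)" .
  have c1: "c 1 = real k - real e1" by (simp add: c_def K_def)
  have X0: "X 0 = real i * (real i - 1) / 2" using i2 by (simp add: X_def of_nat_diff)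
  have XR: "X R = 0" by (simp add: X_def vR)
  \<comment> \<open>Since \<open>(1 / 2) ^ R * i^2\<close> is \<open>(x R)^2\<close>, the missing
    tail is bounded by an absolute constant.\<close>
  have tail: "I * ((1 / 2) ^ R * (if even R then (2 * h1 + h0) / 3 else (2 * h0 + h1) / 3)) \<le> 2 * real i"
  proof -
    have "(1 / 2) ^ R * (real i)\<^sup>2 \<le> 4" using x_R_le unfolding x_square .
    then have "I * (1 / 2) ^ R \<le> 2" by (simp add: I_def mult.commute)
    then have "I * (1 / 2) ^ R * (if even R then (2 * h1 + h0) / 3 else (2 * h0 + h1) / 3) \<le> 2 * 2"
      by (intro mult_mono) (use hb in \<open>auto simp: I_def\<close>)
    then show ?thesis using i2 by (simp only: mult.assoc)
  qed
  define Y where "Y = real i * (real i - 1) / 2"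
  have IY: "I = Y + real i / 2" by (simp add: I_def Y_def power2_eq_square field_simps)
  have e1': "real i / 2 * ((2 * a + b) / 3) \<le> real i / 2 * 1" using ab by (intro mult_left_mono) auto
  have e2': "0 \<le> real i / 2 * ((2 * h1 + h0) / 3)" using hb by (intro mult_nonneg_nonneg) auto
  have ab': "(2 * a + b) / 3 = 1 / 3 + real e1 / 3 - real e0 / 3" by (simp add: a_def b_def field_simps)
  have "(\<Sum>j=1..<i. real j * real (first_cost i j)) \<le>
    (real k - real e1) * Y + I * ((2 * a + b) / 3) - I * ((2 * h1 + h0) / 3) + 2 * real i + 4 * (4 * real i)"
    using main m1 tail sum_x_le[of R] unfolding c1 X0 XR Y_def by (simp add: right_diff_distrib)
  also have "\<dots> \<le> (real k - real e1) * Y + Y * ((2 * a + b) / 3) - Y * ((2 * h1 + h0) / 3) + 19 * real i"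
    unfolding IY distrib_right using e1' e2' by linarith
  also have "\<dots> = Y * (real k + 1 / 3 - (2 * real e1 + real e0) / 3 - (2 * h1 + h0) / 3) + 19 * real i"
    unfolding ab' by (simp add: field_simps)
  finally show ?thesis unfolding Y_def h0_def h1_def .
qed


text \<open>The \<open>7 / 3\<close> in \<open>M\<close> is 1 for comparing the pair,
  \<open>1 / 3\<close> from the probe series and 1 from the search for the larger element. The terms
  \<open>- 2 / p + 1 / (3 * p^2)\<close> are the leading part of \<open>sum_total_gap_cost\<close>
  after substituting \<open>2 ^ k = i / p\<close>.\<close>

lemma sum_merge_cost_le:
  assumes k: "clg (real i) = k" and p: "1 / 2 \<le> p"
    and M: "(7 - (2 * real e1 + real e0)) / 3
      - (2 * h (t1 / p - \<delta>) + h (t0 / p - \<delta>)) / 3 - 2 / p + 1 / (3 * p\<^sup>2) = M"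
  shows "2 * (\<Sum>j=1..<i. real j * (1 + real (first_cost i j)) + total_gap_cost j) \<le>
    real i * (real i - 1) * (2 * real k + M) + 50 * real i"
proof -
  define Y where "Y = real i * (real i - 1) / 2"
  have "(\<Sum>j=1..<i. real j) = (\<Sum>j\<in>{0<..i - 1}. real j)" by (intro sum.cong) auto
  then have a: "(\<Sum>j=1..<i. real j) = Y"
    using sum_greaterThanAtMost_real[of 0 "i - 1"] i2 by (simp add: Y_def of_nat_diff)
  have two: "2 ^ k = real i / p" using ip p_pos by simp
  have "(4::real) ^ k = (2 ^ k)\<^sup>2" by (simp add: power_mult[symmetric] mult.commute[of _ 2] power_mult)
  then have four: "(4::real) ^ k = (real i)\<^sup>2 / p\<^sup>2" unfolding two by (simp add: power_divide)
  define Z where "Z = 2 / p - 1 / (3 * p\<^sup>2)"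
  have "1 / (3 * p\<^sup>2) = 1 / (3 * p) * (1 / p)" by (simp add: power2_eq_square)
  also have "\<dots> \<le> 2 * (1 / p)" using p by (intro mult_right_mono) (auto simp: field_simps)
  finally have Z: "0 \<le> Z" by (simp add: Z_def)
  have "(\<Sum>j=1..<i. total_gap_cost j) = (real k + 1) * Y - (real i)\<^sup>2 / 2 * Z + real i / p / 2 + 1 / 3"
    using sum_total_gap_cost[of i] i2 p_pos unfolding k two four Y_def Z_def
    by (simp add: field_simps power2_eq_square)
  moreover have "(real i)\<^sup>2 / 2 * Z = Y * Z + real i / 2 * Z"
    by (simp add: Y_def power2_eq_square field_simps)
  moreover have "0 \<le> real i / 2 * Z" using Z by (intro mult_nonneg_nonneg) auto
  moreover have "real i * 1 \<le> real i * (2 * p)" using p by (intro mult_left_mono) auto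
  then have "real i / p / 2 \<le> real i" using p_pos by (simp add: field_simps)
  ultimately have "(\<Sum>j=1..<i. total_gap_cost j) \<le> (real k + 1) * Y - Y * Z + 2 * real i"
    using i2 by linarith
  moreover have "(\<Sum>j=1..<i. real j * (1 + real (first_cost i j)) + total_gap_cost j) =
    (\<Sum>j=1..<i. real j) + (\<Sum>j=1..<i. real j * real (first_cost i j)) + (\<Sum>j=1..<i. total_gap_cost j)"
    by (simp add: sum.distrib algebra_simps)
  ultimately have "(\<Sum>j=1..<i. real j * (1 + real (first_cost i j)) + total_gap_cost j) \<le>
     Y + (Y * (real k + 1 / 3 - (2 * real e1 + real e0) / 3 - (2 * h (t1 / p - \<delta>) + h (t0 / p - \<delta>)) / 3) + 19 * real i)
     + ((real k + 1) * Y - Y * Z + 2 * real i)"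
    using sum_first_cost_le unfolding a Y_def by linarith
  also have "\<dots> = Y * (2 * real k + M) + 21 * real i"
    unfolding M[symmetric] Z_def by (simp add: field_simps)
  finally show ?thesis unfolding Y_def by simp
qed

end

text \<open>The breakpoints solve \<open>\<delta> * p = 1 / 4\<close> and
  \<open>\<delta> * p = sqrt 2 / 4\<close>, where the ideal exponent rises by 1 in the even and in
  the odd rounds, respectively.\<close>

definition merge_avg :: "real \<Rightarrow> real" where
  "merge_avg p =
     (if p < (1 + sqrt 2) / 4 then 25 / 3 - 4 * sqrt 2 - 19 / 6 / p + 7 / 16 / p\<^sup>2
      else if p < (2 + sqrt 2) / 4 then 26 / 3 - 4 * sqrt 2 - (3 + sqrt 2 / 3) / p + 1 / 2 / p\<^sup>2
      else 28 / 3 - 4 * sqrt 2 - 13 / 3 / p + 3 / 4 / p\<^sup>2)"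

text \<open>With \<open>s\<close> for \<open>sqrt 2\<close> and \<open>u\<close> for
  \<open>1 / p\<close> these are polynomial identities modulo \<open>s * s = 2\<close>.\<close>

lemma merge_avg_identities:
  fixes s u :: real
  assumes "s * s = 2"
  shows "(7 - (2 * 1 + 1)) / 3 - (2 * (2 * s * (s / 4 * u - (s - 1)) - (s / 4 * u - (s - 1))\<^sup>2)
      + (2 * s * (1 / 4 * u - (s - 1)) - (1 / 4 * u - (s - 1))\<^sup>2)) / 3 - 2 * u + u\<^sup>2 / 3
      = 25 / 3 - 4 * s - 19 / 6 * u + 7 / 16 * u\<^sup>2"
    and "(7 - (2 * 1 + 0)) / 3 - (2 * (2 * s * (s / 4 * u - (s - 1)) - (s / 4 * u - (s - 1))\<^sup>2)
      + (2 * s * (1 / 2 * u - (s - 1)) - (1 / 2 * u - (s - 1))\<^sup>2)) / 3 - 2 * u + u\<^sup>2 / 3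
      = 26 / 3 - 4 * s - (3 + s / 3) * u + 1 / 2 * u\<^sup>2"
    and "(7 - (2 * 0 + 0)) / 3 - (2 * (2 * s * (s / 2 * u - (s - 1)) - (s / 2 * u - (s - 1))\<^sup>2)
      + (2 * s * (1 / 2 * u - (s - 1)) - (1 / 2 * u - (s - 1))\<^sup>2)) / 3 - 2 * u + u\<^sup>2 / 3
      = 28 / 3 - 4 * s - 13 / 3 * u + 3 / 4 * u\<^sup>2"
proof -
  have ss: "s * (s * y) = 2 * y" for y unfolding mult.assoc[symmetric] assms ..
  show "(7 - (2 * 1 + 1)) / 3 - (2 * (2 * s * (s / 4 * u - (s - 1)) - (s / 4 * u - (s - 1))\<^sup>2)
      + (2 * s * (1 / 4 * u - (s - 1)) - (1 / 4 * u - (s - 1))\<^sup>2)) / 3 - 2 * u + u\<^sup>2 / 3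
      = 25 / 3 - 4 * s - 19 / 6 * u + 7 / 16 * u\<^sup>2"
    "(7 - (2 * 1 + 0)) / 3 - (2 * (2 * s * (s / 4 * u - (s - 1)) - (s / 4 * u - (s - 1))\<^sup>2)
      + (2 * s * (1 / 2 * u - (s - 1)) - (1 / 2 * u - (s - 1))\<^sup>2)) / 3 - 2 * u + u\<^sup>2 / 3
      = 26 / 3 - 4 * s - (3 + s / 3) * u + 1 / 2 * u\<^sup>2"
    "(7 - (2 * 0 + 0)) / 3 - (2 * (2 * s * (s / 2 * u - (s - 1)) - (s / 2 * u - (s - 1))\<^sup>2)
      + (2 * s * (1 / 2 * u - (s - 1)) - (1 / 2 * u - (s - 1))\<^sup>2)) / 3 - 2 * u + u\<^sup>2 / 3
      = 28 / 3 - 4 * s - 13 / 3 * u + 3 / 4 * u\<^sup>2"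
    by (simp_all add: field_simps power2_eq_square assms ss)
qed

lemma sum_merge_cost_le_merge_avg:
  assumes i2: "2 \<le> i" and p: "p = p_of (real i)" "1 / 2 \<le> p" "p \<le> 1"
  shows "2 * (\<Sum>j=1..<i. real j * (1 + real (first_cost i j)) + total_gap_cost j) \<le>
    real i * (real i - 1) * (2 * real (clg (real i)) + merge_avg p) + 50 * real i"
proof -
  have ip: "real i = p * 2 ^ clg (real i)" by (simp add: p p_of_def)
  have p0: "0 < p" using p by simp
  have sq: "sqrt 2 * sqrt 2 = 2" by simp
  have d1: "\<delta> * (1 + sqrt 2) = 1" by (simp add: sqrt2_m1_def algebra_simps)
  have d2: "\<delta> * (2 + sqrt 2) = sqrt 2" by (simp add: sqrt2_m1_def algebra_simps)
  have d: "0.414 < \<delta>" "\<delta> < 0.4143" using sqrt2_bounds by (auto simp: sqrt2_m1_def)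
  have "\<delta> * p \<le> \<delta> * 1" "\<delta> * (1 / 2) \<le> \<delta> * p" using d p by (intro mult_left_mono; simp)+
  then have lo: "\<delta> * p \<le> 0.4143" "0.207 \<le> \<delta> * p" using d by linarith+
  have dp: "\<delta> * p \<le> \<delta> * c \<longleftrightarrow> p \<le> c" "\<delta> * c \<le> \<delta> * p \<longleftrightarrow> c \<le> p" for c using d by auto
  consider (zone0) "p < (1 + sqrt 2) / 4" | (zone1) "(1 + sqrt 2) / 4 \<le> p" "p < (2 + sqrt 2) / 4"
    | (zone2) "(2 + sqrt 2) / 4 \<le> p" by linarith
  then show ?thesis
  proof cases
    case zone0
    have b: "p < (2 + sqrt 2) / 4" using zone0 by simp
    interpret round_estimate i "clg (real i)" 1 1 p "1 / 4" "sqrt 2 / 4"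
    proof
      show "\<delta> * p \<le> 1 / 4" using dp(1)[of "(1 + sqrt 2) / 4"] zone0 d1 by simp
      show "\<delta> * p \<le> sqrt 2 / 4" using dp(1)[of "(2 + sqrt 2) / 4"] b d2 by simp
    qed (use i2 ip lo d sqrt2_bounds in \<open>auto simp: power2_eq_square\<close>)
    have "(7 - (2 * real 1 + real 1)) / 3 - (2 * h (sqrt 2 / 4 / p - \<delta>) + h (1 / 4 / p - \<delta>)) / 3
      - 2 / p + 1 / (3 * p\<^sup>2) = merge_avg p"
      using merge_avg_identities(1)[OF sq, of "1 / p"] zone0
      by (simp add: merge_avg_def h_def sqrt2_m1_def power_divide)
    then show ?thesis by (rule sum_merge_cost_le[OF refl p(2)])
  next
    case zone1
    interpret round_estimate i "clg (real i)" 0 1 p "1 / 2" "sqrt 2 / 4"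
    proof
      show "1 / 2 \<le> 2 * \<delta> * p" using dp(2)[of "(1 + sqrt 2) / 4"] zone1 d1 by simp
      show "\<delta> * p \<le> sqrt 2 / 4" using dp(1)[of "(2 + sqrt 2) / 4"] zone1 d2 by simp
    qed (use i2 ip lo d sqrt2_bounds in \<open>auto simp: power2_eq_square\<close>)
    have "(7 - (2 * real 1 + real 0)) / 3 - (2 * h (sqrt 2 / 4 / p - \<delta>) + h (1 / 2 / p - \<delta>)) / 3
      - 2 / p + 1 / (3 * p\<^sup>2) = merge_avg p"
      using merge_avg_identities(2)[OF sq, of "1 / p"] zone1
      by (simp add: merge_avg_def h_def sqrt2_m1_def power_divide)
    then show ?thesis by (rule sum_merge_cost_le[OF refl p(2)])
  next
    case zone2
    have b: "(1 + sqrt 2) / 4 \<le> p" using zone2 by simp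
    interpret round_estimate i "clg (real i)" 0 0 p "1 / 2" "sqrt 2 / 2"
    proof
      show "1 / 2 \<le> 2 * \<delta> * p" using dp(2)[of "(1 + sqrt 2) / 4"] b d1 by simp
      show "sqrt 2 / 2 \<le> 2 * \<delta> * p" using dp(2)[of "(2 + sqrt 2) / 4"] zone2 d2 by simp
    qed (use i2 ip lo d sqrt2_bounds in \<open>auto simp: power2_eq_square\<close>)
    have "(7 - (2 * real 0 + real 0)) / 3 - (2 * h (sqrt 2 / 2 / p - \<delta>) + h (1 / 2 / p - \<delta>)) / 3
      - 2 / p + 1 / (3 * p\<^sup>2) = merge_avg p"
      using merge_avg_identities(3)[OF sq, of "1 / p"] zone2 b
      by (simp add: merge_avg_def h_def sqrt2_m1_def power_divide)
    then show ?thesis by (rule sum_merge_cost_le[OF refl p(2)])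
  qed
qed

section \<open>Numerical values of logarithms\<close>

text \<open>The approximation serves arguments above 1 and improves quickly near 1. So 2 takes
  parameter 11, while the numbers below 1 are first doubled or inverted and get by with 4.\<close>

lemma ln_2_bounds: "0.69314718055 < ln (2::real)" "ln (2::real) < 0.69314718057"
  using ln_approx_bounds[of 2 11] by (simp_all add: eval_nat_numeral)

lemma ln_11022_bounds: "0.09730818245 < ln (1.1022::real)" "ln (1.1022::real) < 0.09730818248"
  using ln_approx_bounds[of "1.1022" 4] by (simp_all add: eval_nat_numeral)

lemma ln_05511_bounds: "- 0.59583899812 < ln (0.5511::real)" "ln (0.5511::real) < - 0.59583899807"
proof -
  have "ln (0.5511::real) = ln (1.1022 / 2)" by simp
  also have "\<dots> = ln 1.1022 - ln 2" by (subst ln_div) auto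
  finally show "- 0.59583899812 < ln (0.5511::real)" "ln (0.5511::real) < - 0.59583899807"
    using ln_2_bounds ln_11022_bounds by linarith+
qed

lemma ln_0888_bounds: "- 0.1187835360 < ln (0.888::real)" "ln (0.888::real) < - 0.1187835359"
proof -
  have "ln (0.888::real) = - ln (125 / 111)" by (simp add: ln_div)
  then show "- 0.1187835360 < ln (0.888::real)" "ln (0.888::real) < - 0.1187835359"
    using ln_approx_bounds[of "125 / 111" 4] by (simp_all add: eval_nat_numeral)
qed

lemma ln_0898305_bounds: "- 0.1072456247 < ln (0.898305::real)" "ln (0.898305::real) < - 0.1072456246"
proof -
  have "ln (0.898305::real) = - ln (200000 / 179661)" by (simp add: ln_div)
  then show "- 0.1072456247 < ln (0.898305::real)" "ln (0.898305::real) < - 0.1072456246"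
    using ln_approx_bounds[of "200000 / 179661" 4] by (simp_all add: eval_nat_numeral)
qed

abbreviation \<beta>\<^sub>1 :: real where "\<beta>\<^sub>1 \<equiv> (1 + sqrt 2) / 4"
abbreviation \<beta>\<^sub>2 :: real where "\<beta>\<^sub>2 \<equiv> (2 + sqrt 2) / 4"

lemma ln_\<beta>\<^sub>2_bounds: "- 0.15834718386 < ln \<beta>\<^sub>2" "ln \<beta>\<^sub>2 < - 0.1583471837"
proof -
  have "ln (0.853553390575::real) < ln \<beta>\<^sub>2" "ln \<beta>\<^sub>2 < ln (0.8535533906::real)"
    using sqrt2_bounds by (subst ln_less_cancel_iff; simp)+
  moreover have "ln (0.853553390575::real) = - ln (1 / 0.853553390575)" by (subst ln_div) simp
  then have "- 0.15834718386 < ln (0.853553390575::real)"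
    using ln_approx_bounds[of "1 / 0.853553390575" 4] by (simp add: eval_nat_numeral)
  moreover have "ln (0.8535533906::real) = - ln (1 / 0.8535533906)" by (subst ln_div) simp
  then have "ln (0.8535533906::real) < - 0.1583471837"
    using ln_approx_bounds[of "1 / 0.8535533906" 4] by (simp add: eval_nat_numeral)
  ultimately show "- 0.15834718386 < ln \<beta>\<^sub>2" "ln \<beta>\<^sub>2 < - 0.1583471837" by linarith+
qed

lemma ln_\<beta>\<^sub>1_bounds: "- 0.50492077415 < ln \<beta>\<^sub>1" "ln \<beta>\<^sub>1 < - 0.5049207739"
proof -
  have "\<beta>\<^sub>1 = \<beta>\<^sub>2 / sqrt 2" by (simp add: field_simps)
  also have "ln \<dots> = ln \<beta>\<^sub>2 - ln (sqrt 2)" by (subst ln_div) (auto simp: add_pos_nonneg less_imp_neq[symmetric])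
  also have "ln (sqrt 2) = ln 2 / 2" by (simp add: ln_sqrt)
  finally show "- 0.50492077415 < ln \<beta>\<^sub>1" "ln \<beta>\<^sub>1 < - 0.5049207739"
    using ln_\<beta>\<^sub>2_bounds ln_2_bounds by (simp_all add: field_simps)
qed


section \<open>The potential\<close>

text \<open>A pair is charged at the \<open>p\<close> where its step begins, hence the rate at the
  left end \<open>a\<close>; for increasing \<open>D\<close> this follows from
  \<open>P' = D / 2\<close>. The integrated form also admits jumps of \<open>P\<close> and
  \<open>D\<close> between pieces.\<close>

definition slope_dominated :: "(real \<Rightarrow> real) \<Rightarrow> (real \<Rightarrow> real) \<Rightarrow> real \<Rightarrow> real \<Rightarrow> bool" where
  "slope_dominated P D x y \<longleftrightarrow> (\<forall>a b. x \<le> a \<and> a \<le> b \<and> b \<le> y \<longrightarrow> D a * (b - a) / 2 \<le> P b - P a)"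

text \<open>An increment across \<open>c\<close> is split there. An upward jump of \<open>P\<close>
  only helps, and the smaller rate \<open>D a\<close> may be used beyond \<open>c\<close>.\<close>

lemma slope_dominated_join:
  assumes "slope_dominated P D x c" "slope_dominated P' D' c y" "P c \<le> P' c"
    and "\<And>a. x \<le> a \<Longrightarrow> a \<le> c \<Longrightarrow> D a \<le> D' c"
  shows "slope_dominated (\<lambda>p. if p < c then P p else P' p) (\<lambda>p. if p < c then D p else D' p) x y"
  unfolding slope_dominated_def
proof (intro allI impI)
  fix a b assume ab: "x \<le> a \<and> a \<le> b \<and> b \<le> y"
  consider "b < c" | "a < c" "c \<le> b" | "c \<le> a" by linarith
  then show "(if a < c then D a else D' a) * (b - a) / 2 \<le>
      (if b < c then P b else P' b) - (if a < c then P a else P' a)"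
  proof cases
    case 1
    then show ?thesis using ab assms(1) unfolding slope_dominated_def by auto
  next
    case 2
    have "D a * (c - a) / 2 \<le> P c - P a" using assms(1) 2 ab unfolding slope_dominated_def by auto
    moreover have "D' c * (b - c) / 2 \<le> P' b - P' c" using assms(2) 2 ab unfolding slope_dominated_def by auto
    moreover have "D a * (b - c) \<le> D' c * (b - c)" using assms(4)[of a] 2 ab by (intro mult_right_mono) auto
    ultimately show ?thesis using assms(3) 2 by (simp add: field_simps)
  next
    case 3
    then show ?thesis using ab assms(2) unfolding slope_dominated_def by auto
  qed
qed

definition rate :: "real \<Rightarrow> real \<Rightarrow> real \<Rightarrow> real \<Rightarrow> real" where
  "rate A B C p = A - B / p + C / p\<^sup>2"

definition prim :: "real \<Rightarrow> real \<Rightarrow> real \<Rightarrow> real \<Rightarrow> real \<Rightarrow> real" where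
  "prim A B C \<kappa> p = (A * p - B * ln p - C / p) / 2 + \<kappa>"

text \<open>For \<open>C > 0\<close> the rate, as a quadratic in \<open>1 / p\<close>, decreases
  until \<open>B / (2 * C)\<close>, which the last assumption places at or beyond
  \<open>1 / a\<close>.\<close>

lemma rate_mono:
  assumes "0 < a" "a \<le> b" "0 \<le> C" "2 * C \<le> B * a"
  shows "rate A B C a \<le> rate A B C b"
proof -
  define u where "u = 1 / a"
  define w where "w = 1 / b"
  have uw: "0 < w" "w \<le> u" using assms by (auto simp: u_def w_def field_simps)
  have "C * w \<le> C * u" using uw assms by (intro mult_left_mono) auto
  moreover have "2 * (C * u) \<le> B" using assms by (simp add: u_def field_simps)
  ultimately have "0 \<le> (u - w) * (B - C * (u + w))"
    using uw by (intro mult_nonneg_nonneg) (auto simp: algebra_simps)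
  moreover have "rate A B C a = A - B * u + C * u * u" "rate A B C b = A - B * w + C * w * w"
    by (simp_all add: rate_def u_def w_def power2_eq_square)
  ultimately show ?thesis by (simp add: algebra_simps)
qed

lemma DERIV_prim:
  "0 < p \<Longrightarrow> (prim A B C \<kappa> has_real_derivative rate A B C p / 2) (at p)"
  unfolding prim_def rate_def
  by (auto intro!: derivative_eq_intros simp: field_simps power2_eq_square)

lemma slope_dominated_prim:
  assumes "0 < x" "0 \<le> C" "2 * C \<le> B * x"
  shows "slope_dominated (prim A B C \<kappa>) (rate A B C) x y"
  unfolding slope_dominated_def
proof (intro allI impI)
  fix a b assume ab: "x \<le> a \<and> a \<le> b \<and> b \<le> y"
  have B: "0 \<le> B" using assms by (smt (verit) mult_nonneg_nonneg zero_le_mult_iff)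
  have "B * x \<le> B * a" using ab B by (intro mult_left_mono) auto
  then have B2: "2 * C \<le> B * a" using assms by linarith
  have "prim A B C \<kappa> a - rate A B C a / 2 * a \<le> prim A B C \<kappa> b - rate A B C a / 2 * b"
  proof (rule DERIV_nonneg_imp_nondecreasing[of a b "\<lambda>t. prim A B C \<kappa> t - rate A B C a / 2 * t"])
    show "a \<le> b" using ab by simp
    fix t assume t: "a \<le> t" "t \<le> b"
    have "((\<lambda>t. prim A B C \<kappa> t - rate A B C a / 2 * t) has_real_derivative
        rate A B C t / 2 - rate A B C a / 2) (at t)"
      using DERIV_prim[of t A B C \<kappa>] t ab assms by (auto intro!: derivative_eq_intros)
    moreover have "rate A B C a \<le> rate A B C t"
      using t ab assms B2 by (intro rate_mono) auto
    ultimately show "\<exists>y. ((\<lambda>t. prim A B C \<kappa> t - rate A B C a / 2 * t) has_real_derivative y) (at t) \<and> 0 \<le> y"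
      by (intro exI[of _ "rate A B C t / 2 - rate A B C a / 2"]) auto
  qed
  then show "rate A B C a * (b - a) / 2 \<le> prim A B C \<kappa> b - prim A B C \<kappa> a"
    by (simp add: field_simps)
qed

text \<open>The first is the rate of two RHBS insertions, the others are the branches of
  \<open>merge_avg\<close>.\<close>

abbreviation "rate\<^sub>1 \<equiv> rate 2 2 0"
abbreviation "rate\<^sub>2 \<equiv> rate (25 / 3 - 4 * sqrt 2) (19 / 6) (7 / 16)"
abbreviation "rate\<^sub>3 \<equiv> rate (26 / 3 - 4 * sqrt 2) (3 + sqrt 2 / 3) (1 / 2)"
abbreviation "rate\<^sub>4 \<equiv> rate (28 / 3 - 4 * sqrt 2) (13 / 3) (3 / 4)"

text \<open>The last constants are rounded so that each piece starts about \<open>2e-8\<close> above the end of the previous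
  one, and the value at \<open>1\<close> stays just below twice the value at \<open>1 / 2\<close>.\<close>

abbreviation "prim\<^sub>1 \<equiv> prim 2 2 0 (- 1.394760168)"
abbreviation "prim\<^sub>2 \<equiv> prim (25 / 3 - 4 * sqrt 2) (19 / 6) (7 / 16) (- 1.531803303)"
abbreviation "prim\<^sub>3 \<equiv> prim (26 / 3 - 4 * sqrt 2) (3 + sqrt 2 / 3) (1 / 2) (- 1.657553056)"
abbreviation "prim\<^sub>4 \<equiv> prim (28 / 3 - 4 * sqrt 2) (13 / 3) (3 / 4) (- 1.863866224)"
abbreviation "prim\<^sub>5 \<equiv> prim 2 2 0 (- 1.403225996)"

definition step_rate :: "real \<Rightarrow> real" where
  "step_rate p = (if p < 0.5511 then rate\<^sub>1 p else if p < \<beta>\<^sub>1 then rate\<^sub>2 p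
     else if p < \<beta>\<^sub>2 then rate\<^sub>3 p else if p < 0.888 then rate\<^sub>4 p else rate\<^sub>1 p)"

definition profile :: "real \<Rightarrow> real" where
  "profile p = (if p < 0.5511 then prim\<^sub>1 p else if p < \<beta>\<^sub>1 then prim\<^sub>2 p
     else if p < \<beta>\<^sub>2 then prim\<^sub>3 p else if p < 0.888 then prim\<^sub>4 p else prim\<^sub>5 p)"

lemma inverse_\<beta>: "1 / \<beta>\<^sub>1 = 4 * (sqrt 2 - 1)" "1 / \<beta>\<^sub>2 = 4 - 2 * sqrt 2"
proof -
  have "1 + sqrt 2 > 0" "2 + sqrt 2 > 0" using sqrt2_bounds by auto
  then show "1 / \<beta>\<^sub>1 = 4 * (sqrt 2 - 1)" "1 / \<beta>\<^sub>2 = 4 - 2 * sqrt 2"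
    by (simp_all add: field_simps)
qed

lemma rate_alt: "rate A B C p = A - B * (1 / p) + C * ((1 / p) * (1 / p))"
  by (simp add: rate_def power2_eq_square)

lemma prim_alt: "prim A B C \<kappa> p = (A * p - B * ln p - C * (1 / p)) / 2 + \<kappa>"
  by (simp add: prim_def)

text \<open>The rate is continuous at a breakpoint: the ideal block length is then a power of two,
  and taking that exponent with no cheap gap or the next one with all gaps cheap charges the
  same.\<close>

lemma rate_at_\<beta>: "rate\<^sub>2 \<beta>\<^sub>1 = 42 - 92 / 3 * sqrt 2" "rate\<^sub>3 \<beta>\<^sub>1 = 42 - 92 / 3 * sqrt 2"
  "rate\<^sub>3 \<beta>\<^sub>2 = 10 - 22 / 3 * sqrt 2" "rate\<^sub>4 \<beta>\<^sub>2 = 10 - 22 / 3 * sqrt 2"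
  unfolding rate_alt inverse_\<beta> by (simp_all add: field_simps)

lemma \<beta>_bounds: "0.60355 < \<beta>\<^sub>1" "\<beta>\<^sub>1 < 0.60356" "0.85355 < \<beta>\<^sub>2" "\<beta>\<^sub>2 < 0.85356"
  using sqrt2_bounds by auto

lemma prim_jumps:
  "prim\<^sub>1 0.5511 \<le> prim\<^sub>2 0.5511" "prim\<^sub>2 \<beta>\<^sub>1 \<le> prim\<^sub>3 \<beta>\<^sub>1" "prim\<^sub>3 \<beta>\<^sub>2 \<le> prim\<^sub>4 \<beta>\<^sub>2"
  "prim\<^sub>4 0.888 \<le> prim\<^sub>5 0.888" "prim\<^sub>5 1 \<le> 2 * prim\<^sub>1 (1 / 2)"
proof -
  show "prim\<^sub>1 0.5511 \<le> prim\<^sub>2 0.5511"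
    using ln_05511_bounds sqrt2_bounds unfolding prim_def by (simp add: field_simps)
  show "prim\<^sub>4 0.888 \<le> prim\<^sub>5 0.888"
    using ln_0888_bounds sqrt2_bounds unfolding prim_def by (simp add: field_simps)
  have "ln (1 / 2 :: real) = - ln 2" by (simp add: ln_div)
  then show "prim\<^sub>5 1 \<le> 2 * prim\<^sub>1 (1 / 2)" using ln_2_bounds unfolding prim_def by (simp add: field_simps)
  \<comment> \<open>\<open>sqrt 2 * ln \<beta>\<^sub>1\<close> is a product of two enclosed numbers,
    hence not linear. Its coefficient in the difference of the sides is enclosed as a whole, which
    loses less than enclosing each side.\<close>
  have "(1.4142135623 / 3 - 1 / 6) * 0.5049207739 \<le> (sqrt 2 / 3 - 1 / 6) * (- ln \<beta>\<^sub>1)"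
    using sqrt2_bounds ln_\<beta>\<^sub>1_bounds by (intro mult_mono) auto
  moreover have ss: "sqrt 2 * (sqrt 2 * y) = 2 * y" for y by (simp flip: mult.assoc)
  ultimately show "prim\<^sub>2 \<beta>\<^sub>1 \<le> prim\<^sub>3 \<beta>\<^sub>1"
    using sqrt2_bounds ln_\<beta>\<^sub>1_bounds unfolding prim_alt inverse_\<beta> by (simp add: field_simps ss)
  have "(4 / 3 - 1.4142135624 / 3) * 0.1583471837 \<le> (4 / 3 - sqrt 2 / 3) * (- ln \<beta>\<^sub>2)"
    using sqrt2_bounds ln_\<beta>\<^sub>2_bounds by (intro mult_mono) auto
  then show "prim\<^sub>3 \<beta>\<^sub>2 \<le> prim\<^sub>4 \<beta>\<^sub>2"
    using sqrt2_bounds ln_\<beta>\<^sub>2_bounds unfolding prim_alt inverse_\<beta> by (simp add: field_simps ss)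
qed


text \<open>The thresholds of the algorithm lie just left of the points where the two curves cross,
  so the rate jumps upward there, by less than \<open>1e-4\<close>, and the combined rate stays
  increasing.\<close>

lemma rate_jumps: "rate\<^sub>1 0.5511 \<le> rate\<^sub>2 0.5511" "rate\<^sub>4 0.888 \<le> rate\<^sub>1 0.888"
  using sqrt2_bounds unfolding rate_def by (simp_all add: field_simps power2_eq_square)

lemma slope_dominated_profile: "slope_dominated profile step_rate (1 / 2) 1"
proof -
  note b = \<beta>_bounds
  have s1: "slope_dominated prim\<^sub>1 rate\<^sub>1 (1 / 2) 0.5511" and s5: "slope_dominated prim\<^sub>5 rate\<^sub>1 0.888 1"
    and s2: "slope_dominated prim\<^sub>2 rate\<^sub>2 0.5511 \<beta>\<^sub>1"
    by (intro slope_dominated_prim; simp)+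
  have s3: "slope_dominated prim\<^sub>3 rate\<^sub>3 \<beta>\<^sub>1 \<beta>\<^sub>2"
  proof (rule slope_dominated_prim)
    have "3 * 0.6 \<le> (3 + sqrt 2 / 3) * \<beta>\<^sub>1" using b by (intro mult_mono) auto
    then show "2 * (1 / 2) \<le> (3 + sqrt 2 / 3) * \<beta>\<^sub>1" by linarith
  qed (use b in auto)
  have s4: "slope_dominated prim\<^sub>4 rate\<^sub>4 \<beta>\<^sub>2 0.888"
    by (rule slope_dominated_prim) (use b in auto)
  have m: "rate A B C a \<le> rate A B C c" if "0 \<le> C" "2 * C \<le> B * a" "0 < a" "a \<le> c" for A B C a c
    using that by (intro rate_mono)
  have t4: "slope_dominated (\<lambda>p. if p < 0.888 then prim\<^sub>4 p else prim\<^sub>5 p)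
      (\<lambda>p. if p < 0.888 then rate\<^sub>4 p else rate\<^sub>1 p) \<beta>\<^sub>2 1" (is "slope_dominated ?P4 ?D4 _ _")
  proof (rule slope_dominated_join[OF s4 s5 prim_jumps(4)])
    fix a assume "\<beta>\<^sub>2 \<le> a" "a \<le> 0.888"
    then have "rate\<^sub>4 a \<le> rate\<^sub>4 0.888" using b by (intro m) auto
    then show "rate\<^sub>4 a \<le> rate\<^sub>1 0.888" using rate_jumps by simp
  qed
  have t3: "slope_dominated (\<lambda>p. if p < \<beta>\<^sub>2 then prim\<^sub>3 p else ?P4 p)
      (\<lambda>p. if p < \<beta>\<^sub>2 then rate\<^sub>3 p else ?D4 p) \<beta>\<^sub>1 1" (is "slope_dominated ?P3 ?D3 _ _")
  proof (rule slope_dominated_join[OF s3 t4])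
    have lt: "\<beta>\<^sub>2 < 0.888" using b by simp
    then show "prim\<^sub>3 \<beta>\<^sub>2 \<le> ?P4 \<beta>\<^sub>2" using prim_jumps(3) by simp
    fix a assume a: "\<beta>\<^sub>1 \<le> a" "a \<le> \<beta>\<^sub>2"
    have "3 * 0.6 \<le> (3 + sqrt 2 / 3) * a" using b a by (intro mult_mono) auto
    then have "2 * (1 / 2) \<le> (3 + sqrt 2 / 3) * a" by linarith
    then have "rate\<^sub>3 a \<le> rate\<^sub>3 \<beta>\<^sub>2" using b a by (intro m) auto
    then show "rate\<^sub>3 a \<le> ?D4 \<beta>\<^sub>2" using rate_at_\<beta> lt by simp
  qed
  have t2: "slope_dominated (\<lambda>p. if p < \<beta>\<^sub>1 then prim\<^sub>2 p else ?P3 p)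
      (\<lambda>p. if p < \<beta>\<^sub>1 then rate\<^sub>2 p else ?D3 p) 0.5511 1" (is "slope_dominated ?P2 ?D2 _ _")
  proof (rule slope_dominated_join[OF s2 t3])
    show "prim\<^sub>2 \<beta>\<^sub>1 \<le> ?P3 \<beta>\<^sub>1" using prim_jumps(2) by simp
    fix a assume "0.5511 \<le> a" "a \<le> \<beta>\<^sub>1"
    then have "rate\<^sub>2 a \<le> rate\<^sub>2 \<beta>\<^sub>1" using b by (intro m) auto
    then show "rate\<^sub>2 a \<le> ?D3 \<beta>\<^sub>1" using rate_at_\<beta> by simp
  qed
  have "slope_dominated (\<lambda>p. if p < 0.5511 then prim\<^sub>1 p else ?P2 p)
      (\<lambda>p. if p < 0.5511 then rate\<^sub>1 p else ?D2 p) (1 / 2) 1"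
  proof (rule slope_dominated_join[OF s1 t2])
    have lt: "0.5511 < \<beta>\<^sub>1" using b by simp
    then show "prim\<^sub>1 0.5511 \<le> ?P2 0.5511" using prim_jumps(1) by simp
    fix a :: real assume "1 / 2 \<le> a" "a \<le> 0.5511"
    then have "rate\<^sub>1 a \<le> rate\<^sub>1 0.5511" by (intro m) auto
    then show "rate\<^sub>1 a \<le> ?D2 0.5511" using rate_jumps lt by simp
  qed
  then show ?thesis unfolding profile_def step_rate_def .
qed

text \<open>The deficit in \<open>P p \<le> p lg p - 1.40118 p + 1\<close>, multiplied by \<open>ln 2\<close>.\<close>

definition slack :: "real \<Rightarrow> real \<Rightarrow> real \<Rightarrow> real \<Rightarrow> real \<Rightarrow> real" where
  "slack A B C \<kappa> p = p * ln p + ln 2 * (1 - 1.40118 * p - prim A B C \<kappa> p)"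

definition slack' :: "real \<Rightarrow> real \<Rightarrow> real \<Rightarrow> real \<Rightarrow> real" where
  "slack' A B C p = ln p + 1 - ln 2 * (1.40118 + rate A B C p / 2)"

lemma DERIV_slack:
  "0 < p \<Longrightarrow> (slack A B C \<kappa> has_real_derivative slack' A B C p) (at p)"
  unfolding slack_def slack'_def
  by (rule derivative_eq_intros DERIV_prim refl | simp add: algebra_simps)+

lemma convex_on_le_endpoints:
  fixes f :: "real \<Rightarrow> real"
  assumes "convex_on {a..b} f" "f a \<le> M" "f b \<le> M" "x \<in> {a..b}"
  shows "f x \<le> M"
proof (cases "a = b")
  case False
  define t where "t = (x - a) / (b - a)"
  have "t * (b - a) = x - a" using False by (simp add: t_def)
  then have "(1 - t) * a + t * b = x" by (simp add: algebra_simps)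
  moreover have t: "0 \<le> t" "t \<le> 1" using False assms(4) by (auto simp: t_def field_simps)
  ultimately have "f x \<le> (1 - t) * f a + t * f b"
    using convex_onD_Icc[OF assms(1), of t] assms(4) by simp
  also have "\<dots> \<le> (1 - t) * M + t * M" using t assms by (intro add_mono mult_left_mono) auto
  finally show ?thesis by (simp add: algebra_simps)
qed (use assms in auto)

text \<open>Reduces an interval to three numbers: the sign of the derivative at both ends, and the
  slack at the right end, where it is smallest.\<close>

lemma slack_antimono:
  assumes c: "0 < c" "c \<le> p" "p \<le> d" and C: "ln 2 * C \<le> c\<^sup>2"
    and ends: "slack' A B C c \<le> 0" "slack' A B C d \<le> 0"
  shows "slack A B C \<kappa> d \<le> slack A B C \<kappa> p"
proof -
  define g where "g q = - ln q + 1 - ln 2 * (1.40118 + (A - B * q + C * q\<^sup>2) / 2)" for q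
  have gs: "slack' A B C t = g (1 / t)" if "0 < t" for t
    using that by (simp add: slack'_def g_def rate_def ln_div power_divide)
  \<comment> \<open>The derivative of the slack is a convex function of \<open>1 / p\<close>.\<close>
  have "convex_on {1 / d..1 / c} g"
  proof (rule f''_ge0_imp_convex)
    fix q assume q: "q \<in> {1 / d..1 / c}"
    then have q0: "0 < q" using c by (smt (verit) atLeastAtMost_iff divide_pos_pos)
    show "(g has_real_derivative - 1 / q - ln 2 * ((- B + 2 * C * q) / 2)) (at q)"
      unfolding g_def using q0 by (auto intro!: derivative_eq_intros simp: field_simps)
    show "((\<lambda>q. - 1 / q - ln 2 * ((- B + 2 * C * q) / 2)) has_real_derivative (1 / q\<^sup>2 - ln 2 * C)) (at q)"
      using q0 by (auto intro!: derivative_eq_intros simp: power2_eq_square field_simps)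
    have "c \<le> 1 / q" using q q0 c by (auto simp: field_simps)
    then have "c\<^sup>2 \<le> (1 / q)\<^sup>2" using c by (intro power_mono) auto
    then show "0 \<le> 1 / q\<^sup>2 - ln 2 * C" using C by (simp add: power_divide)
  qed simp
  then have le0: "slack' A B C t \<le> 0" if t: "c \<le> t" "t \<le> d" for t
  proof -
    have "1 / t \<in> {1 / d..1 / c}" using t c by (auto simp: field_simps)
    from convex_on_le_endpoints[OF \<open>convex_on {1 / d..1 / c} g\<close> _ _ this, of 0]
    show ?thesis using ends gs[of c] gs[of d] gs[of t] c t by simp
  qed
  show ?thesis
  proof (rule DERIV_nonpos_imp_nonincreasing[of p d "slack A B C \<kappa>"])
    fix t assume t: "p \<le> t" "t \<le> d"
    then show "\<exists>y. (slack A B C \<kappa> has_real_derivative y) (at t) \<and> y \<le> 0"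
      using DERIV_slack[of t A B C \<kappa>] le0[of t] c by (intro exI[of _ "slack' A B C t"]) auto
  qed (use c in auto)
qed

lemma ln_2_mult_ge:
  fixes q Q :: real
  assumes "q \<le> Q" "0 \<le> q"
  shows "0.69314718055 * q \<le> ln 2 * Q"
  using assms ln_2_bounds by (intro mult_mono) auto

text \<open>The factor of \<open>ln 2\<close> is first bounded below by a nearby rational, after
  which only linear estimates remain. At a breakpoint the adjacent pieces share one check, since
  their rates agree.\<close>

lemma slack'_endpoints:
  "slack' (25 / 3 - 4 * sqrt 2) (19 / 6) (7 / 16) 0.5511 \<le> 0"
  "slack' (25 / 3 - 4 * sqrt 2) (19 / 6) (7 / 16) \<beta>\<^sub>1 \<le> 0"
  "slack' (26 / 3 - 4 * sqrt 2) (3 + sqrt 2 / 3) (1 / 2) \<beta>\<^sub>1 \<le> 0"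
  "slack' (26 / 3 - 4 * sqrt 2) (3 + sqrt 2 / 3) (1 / 2) \<beta>\<^sub>2 \<le> 0"
  "slack' (28 / 3 - 4 * sqrt 2) (13 / 3) (3 / 4) \<beta>\<^sub>2 \<le> 0"
  "slack' (28 / 3 - 4 * sqrt 2) (13 / 3) (3 / 4) 0.888 \<le> 0"
proof -
  have "0.5866 \<le> 1.40118 + rate\<^sub>2 0.5511 / 2"
    using sqrt2_bounds unfolding rate_def by (simp add: field_simps power2_eq_square)
  from ln_2_mult_ge[OF this]
  show "slack' (25 / 3 - 4 * sqrt 2) (19 / 6) (7 / 16) 0.5511 \<le> 0"
    unfolding slack'_def using ln_05511_bounds by simp
  have "1.27503 \<le> 1.40118 + rate\<^sub>4 0.888 / 2"
    using sqrt2_bounds unfolding rate_def by (simp add: field_simps power2_eq_square)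
  from ln_2_mult_ge[OF this]
  show "slack' (28 / 3 - 4 * sqrt 2) (13 / 3) (3 / 4) 0.888 \<le> 0"
    unfolding slack'_def using ln_0888_bounds by simp
  have "0.71657 \<le> 1.40118 + (42 - 92 / 3 * sqrt 2) / 2" using sqrt2_bounds by (simp add: field_simps)
  from ln_2_mult_ge[OF this]
  show "slack' (25 / 3 - 4 * sqrt 2) (19 / 6) (7 / 16) \<beta>\<^sub>1 \<le> 0"
    "slack' (26 / 3 - 4 * sqrt 2) (3 + sqrt 2 / 3) (1 / 2) \<beta>\<^sub>1 \<le> 0"
    unfolding slack'_def rate_at_\<beta> using ln_\<beta>\<^sub>1_bounds by (simp_all add: field_simps)
  have "1.21573 \<le> 1.40118 + (10 - 22 / 3 * sqrt 2) / 2" using sqrt2_bounds by (simp add: field_simps)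
  from ln_2_mult_ge[OF this]
  show "slack' (26 / 3 - 4 * sqrt 2) (3 + sqrt 2 / 3) (1 / 2) \<beta>\<^sub>2 \<le> 0"
    "slack' (28 / 3 - 4 * sqrt 2) (13 / 3) (3 / 4) \<beta>\<^sub>2 \<le> 0"
    unfolding slack'_def rate_at_\<beta> using ln_\<beta>\<^sub>2_bounds by (simp_all add: field_simps)
qed

abbreviation "slack\<^sub>1 \<equiv> slack 2 2 0 (- 1.394760168)"
abbreviation "slack\<^sub>2 \<equiv> slack (25 / 3 - 4 * sqrt 2) (19 / 6) (7 / 16) (- 1.531803303)"
abbreviation "slack\<^sub>3 \<equiv> slack (26 / 3 - 4 * sqrt 2) (3 + sqrt 2 / 3) (1 / 2) (- 1.657553056)"
abbreviation "slack\<^sub>4 \<equiv> slack (28 / 3 - 4 * sqrt 2) (13 / 3) (3 / 4) (- 1.863866224)"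
abbreviation "slack\<^sub>5 \<equiv> slack 2 2 0 (- 1.403225996)"

lemma slack_endpoints:
  "0 \<le> slack\<^sub>1 (1 / 2)" "0 \<le> slack\<^sub>1 0.5511" "0 \<le> slack\<^sub>2 \<beta>\<^sub>1" "0 \<le> slack\<^sub>3 \<beta>\<^sub>2"
  "0 \<le> slack\<^sub>4 0.888" "0.00000005 \<le> slack\<^sub>5 0.898305"
proof -
  have l: "ln (1 / 2 :: real) = - ln 2" by (simp add: ln_div)
  \<comment> \<open>All logarithms at \<open>1 / 2\<close> are multiples of \<open>ln 2\<close>, and
    the slack there simplifies to this product.\<close>
  have "0 \<le> ln 2 * (0.694170168 - ln 2 :: real)" using ln_2_bounds by (intro mult_nonneg_nonneg) auto
  then show "0 \<le> slack\<^sub>1 (1 / 2)" unfolding slack_def prim_def l by (simp add: field_simps)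
  have "0.47563 \<le> 1 - 1.40118 * 0.5511 - prim\<^sub>1 0.5511"
    using ln_05511_bounds unfolding prim_def by (simp add: field_simps)
  from ln_2_mult_ge[OF this]
  show "0 \<le> slack\<^sub>1 0.5511" unfolding slack_def using ln_05511_bounds by (simp add: field_simps)
  have "0.152194638 \<le> 1 - 1.40118 * 0.888 - prim\<^sub>4 0.888"
    using ln_0888_bounds sqrt2_bounds unfolding prim_def by (simp add: field_simps)
  from ln_2_mult_ge[OF this]
  show "0 \<le> slack\<^sub>4 0.888" unfolding slack_def using ln_0888_bounds by (simp add: field_simps)
  have "0.13898837 \<le> 1 - 1.40118 * 0.898305 - prim\<^sub>5 0.898305"
    using ln_0898305_bounds unfolding prim_def by (simp add: field_simps)
  from ln_2_mult_ge[OF this]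
  show "0.00000005 \<le> slack\<^sub>5 0.898305" unfolding slack_def using ln_0898305_bounds by (simp add: field_simps)
  have ss: "sqrt 2 * (sqrt 2 * y) = 2 * y" for y by (simp flip: mult.assoc)
  have "0.4413 \<le> 1 - 1.40118 * \<beta>\<^sub>1 - prim\<^sub>2 \<beta>\<^sub>1"
    using ln_\<beta>\<^sub>1_bounds sqrt2_bounds unfolding prim_alt inverse_\<beta> by (simp add: field_simps ss)
  from ln_2_mult_ge[OF this]
  have "0.69314718055 * 0.4413 \<le> ln 2 * (1 - 1.40118 * \<beta>\<^sub>1 - prim\<^sub>2 \<beta>\<^sub>1)" by simp
  moreover have "\<beta>\<^sub>1 * (- ln \<beta>\<^sub>1) \<le> 0.60356 * 0.50492077415"
    using \<beta>_bounds ln_\<beta>\<^sub>1_bounds by (intro mult_mono) auto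
  ultimately show "0 \<le> slack\<^sub>2 \<beta>\<^sub>1" unfolding slack_def by simp
  have "(3 + sqrt 2 / 3) * 0.1583471837 \<le> (3 + sqrt 2 / 3) * (- ln \<beta>\<^sub>2)"
    using sqrt2_bounds ln_\<beta>\<^sub>2_bounds by (intro mult_mono) auto
  moreover have "(3 + sqrt 2 / 3) * (- ln \<beta>\<^sub>2) \<le> (3 + 1.4142135624 / 3) * 0.15834718386"
    using sqrt2_bounds ln_\<beta>\<^sub>2_bounds by (intro mult_mono) auto
  ultimately have "0.1951029 \<le> 1 - 1.40118 * \<beta>\<^sub>2 - prim\<^sub>3 \<beta>\<^sub>2"
    using ln_\<beta>\<^sub>2_bounds sqrt2_bounds unfolding prim_alt inverse_\<beta> by (simp add: field_simps ss)
  from ln_2_mult_ge[OF this]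
  have "0.69314718055 * 0.1951029 \<le> ln 2 * (1 - 1.40118 * \<beta>\<^sub>2 - prim\<^sub>3 \<beta>\<^sub>2)" by simp
  moreover have "\<beta>\<^sub>2 * (- ln \<beta>\<^sub>2) \<le> 0.8535533906 * 0.15834718386"
    using sqrt2_bounds ln_\<beta>\<^sub>2_bounds by (intro mult_mono) auto
  ultimately show "0 \<le> slack\<^sub>3 \<beta>\<^sub>2" unfolding slack_def by simp
qed

text \<open>The second derivative changes sign at \<open>p = ln 2\<close>, which lies between the
  two intervals using RHBS only: the slack is concave on the left one, so its ends suffice, and
  convex on the right one.\<close>

lemma DERIV_slack'_1:
  "0 < p \<Longrightarrow> (slack' 2 2 0 has_real_derivative (p - ln 2) / p\<^sup>2) (at p)"
  unfolding slack'_def rate_def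
  by (auto intro!: derivative_eq_intros simp: field_simps power2_eq_square)

lemma slack\<^sub>1_nonneg:
  assumes "1 / 2 \<le> p" "p \<le> 0.5511"
  shows "0 \<le> slack\<^sub>1 p"
proof -
  have "convex_on {1 / 2..0.5511} (\<lambda>p. - slack\<^sub>1 p)"
  proof (rule f''_ge0_imp_convex)
    fix t :: real assume t: "t \<in> {1 / 2..0.5511}"
    then have "0 < t" by auto
    then show "((\<lambda>p. - slack\<^sub>1 p) has_real_derivative - slack' 2 2 0 t) (at t)"
      by (intro DERIV_minus DERIV_slack)
    show "((\<lambda>p. - slack' 2 2 0 p) has_real_derivative - ((t - ln 2) / t\<^sup>2)) (at t)"
      using \<open>0 < t\<close> by (intro DERIV_minus DERIV_slack'_1)
    show "0 \<le> - ((t - ln 2) / t\<^sup>2)" using t ln_2_bounds by (simp add: divide_nonpos_pos)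
  qed simp
  from convex_on_le_endpoints[OF this, of 0 p] show ?thesis
    using assms slack_endpoints by auto
qed

text \<open>The point 0.898305 approximates the minimum. By convexity the slack lies above its
  tangent there, whose slope of at most \<open>1e-7\<close>, over a distance below 0.2, cannot use
  up the value \<open>5e-8\<close>.\<close>

lemma slack\<^sub>5_nonneg:
  assumes "0.888 \<le> p" "p \<le> 1"
  shows "0 \<le> slack\<^sub>5 p"
proof -
  have "slack' 2 2 0 0.898305 * (p - 0.898305) \<le> slack\<^sub>5 p - slack\<^sub>5 0.898305"
  proof (rule f''_imp_f'[of "{0.888..1}" _ _ "\<lambda>t. (t - ln 2) / t\<^sup>2"])
    fix t :: real assume t: "t \<in> {0.888..1}"
    then have "0 < t" by auto
    then show "(slack\<^sub>5 has_real_derivative slack' 2 2 0 t) (at t)" by (rule DERIV_slack)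
    show "(slack' 2 2 0 has_real_derivative (t - ln 2) / t\<^sup>2) (at t)"
      using \<open>0 < t\<close> by (rule DERIV_slack'_1)
    show "0 \<le> (t - ln 2) / t\<^sup>2" using t ln_2_bounds by simp
  qed (use assms in auto)
  moreover have "\<bar>slack' 2 2 0 0.898305\<bar> \<le> 0.0000001"
    unfolding slack'_def rate_def using ln_2_bounds ln_0898305_bounds by (simp add: field_simps abs_le_iff)
  moreover have "\<bar>p - 0.898305\<bar> \<le> 0.2" unfolding abs_le_iff using assms by simp
  with calculation(2) have "\<bar>slack' 2 2 0 0.898305 * (p - 0.898305)\<bar> \<le> 0.0000001 * 0.2"
    unfolding abs_mult by (rule mult_mono) simp_all
  ultimately show ?thesis using slack_endpoints(6) by simp
qed

lemma profile_le:
  assumes "1 / 2 \<le> p" "p \<le> 1"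
  shows "profile p \<le> p * log 2 p - 1.40118 * p + 1"
proof -
  note b = \<beta>_bounds
  have *: "prim A B C \<kappa> p \<le> p * log 2 p - 1.40118 * p + 1" if "0 \<le> slack A B C \<kappa> p" for A B C \<kappa>
  proof -
    have "ln 2 > (0::real)" by simp
    then show ?thesis using that unfolding slack_def log_def by (simp add: field_simps)
  qed
  have 2: "0 \<le> slack\<^sub>2 p" if "0.5511 \<le> p" "p \<le> \<beta>\<^sub>1"
  proof -
    have "ln 2 * (7 / 16) \<le> (0.5511::real)\<^sup>2" using ln_2_bounds by (simp add: power2_eq_square)
    from slack_antimono[OF _ that this slack'_endpoints(1,2)] slack_endpoints(3)
    show ?thesis by (simp add: order_trans)
  qed
  have 3: "0 \<le> slack\<^sub>3 p" if "\<beta>\<^sub>1 \<le> p" "p \<le> \<beta>\<^sub>2"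
  proof -
    have "0.6\<^sup>2 \<le> \<beta>\<^sub>1\<^sup>2" using b by (intro power_mono) auto
    then have "ln 2 * (1 / 2) \<le> \<beta>\<^sub>1\<^sup>2" using ln_2_bounds by (simp add: power2_eq_square)
    from slack_antimono[OF _ that this slack'_endpoints(3,4)] slack_endpoints(4) b
    show ?thesis by (simp add: order_trans)
  qed
  have 4: "0 \<le> slack\<^sub>4 p" if "\<beta>\<^sub>2 \<le> p" "p \<le> 0.888"
  proof -
    have "0.8\<^sup>2 \<le> \<beta>\<^sub>2\<^sup>2" using b by (intro power_mono) auto
    then have "ln 2 * (3 / 4) \<le> \<beta>\<^sub>2\<^sup>2" using ln_2_bounds by (simp add: power2_eq_square)
    from slack_antimono[OF _ that this slack'_endpoints(5,6)] slack_endpoints(5) b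
    show ?thesis by (simp add: order_trans)
  qed
  consider "p < 0.5511" | "0.5511 \<le> p" "p < \<beta>\<^sub>1" | "\<beta>\<^sub>1 \<le> p" "p < \<beta>\<^sub>2"
    | "\<beta>\<^sub>2 \<le> p" "p < 0.888" | "0.888 \<le> p" by linarith
  then show ?thesis
  proof cases
    case c1: 1
    then have "profile p = prim\<^sub>1 p" unfolding profile_def by (simp only: if_True)
    then show ?thesis using *[OF slack\<^sub>1_nonneg] c1 assms by simp
  next
    case c2: 2
    then have "profile p = prim\<^sub>2 p" unfolding profile_def by (simp only: not_less[symmetric] if_True if_False)
    then show ?thesis using *[OF 2] c2 by simp
  next
    case c3: 3
    then have "\<not> p < 0.5511" using b by simp
    then have "profile p = prim\<^sub>3 p" unfolding profile_def
      using c3 by (simp only: not_less[symmetric] if_True if_False)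
    then show ?thesis using *[OF 3] c3 by simp
  next
    case c4: 4
    then have "\<not> p < 0.5511" "\<not> p < \<beta>\<^sub>1" using b by auto
    then have "profile p = prim\<^sub>4 p" unfolding profile_def
      using c4 by (simp only: not_less[symmetric] if_True if_False)
    then show ?thesis using *[OF 4] c4 by simp
  next
    case c5: 5
    then have "\<not> p < 0.5511" "\<not> p < \<beta>\<^sub>1" "\<not> p < \<beta>\<^sub>2" using b by auto
    then have "profile p = prim\<^sub>5 p" unfolding profile_def
      using c5 by (simp only: not_less[symmetric] if_True if_False)
    then show ?thesis using *[OF slack\<^sub>5_nonneg] c5 assms by simp
  qed
qed


section \<open>The step from \<open>n\<close> to \<open>n + 2\<close>\<close>

lemma step_rate_ge:
  "p < 0.5511 \<or> 0.888 < p \<Longrightarrow> 2 - 2 / p \<le> step_rate p"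
  "0.5511 \<le> p \<Longrightarrow> p \<le> 0.888 \<Longrightarrow> merge_avg p \<le> step_rate p"
proof -
  note b = \<beta>_bounds
  have r1: "rate\<^sub>1 p = 2 - 2 / p" by (simp add: rate_def)
  show "2 - 2 / p \<le> step_rate p" if "p < 0.5511 \<or> 0.888 < p"
    using that
  proof
    assume "p < 0.5511"
    then have "step_rate p = rate\<^sub>1 p" unfolding step_rate_def by (simp only: if_True)
    then show ?thesis using r1 by simp
  next
    assume p: "0.888 < p"
    then have "\<not> p < 0.5511" "\<not> p < \<beta>\<^sub>1" "\<not> p < \<beta>\<^sub>2" "\<not> p < 0.888" using b by auto
    then have "step_rate p = rate\<^sub>1 p" unfolding step_rate_def by (simp only: if_False)
    then show ?thesis using r1 by simp
  qed
  show "merge_avg p \<le> step_rate p" if p: "0.5511 \<le> p" "p \<le> 0.888"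
  proof (cases "p < 0.888")
    case True
    have "\<not> p < 0.5511" using p by simp
    then have "merge_avg p = step_rate p"
      unfolding step_rate_def merge_avg_def rate_def using True by (simp only: if_True if_False)
    then show ?thesis by simp
  next
    \<comment> \<open>At exactly 0.888 the algorithm still uses 2Merge while
      \<open>step_rate\<close> has already switched; the switch is upward.\<close>
    case False
    then have p: "p = 0.888" using p by simp
    have "\<not> (0.888::real) < 0.5511" "\<not> 0.888 < \<beta>\<^sub>1" "\<not> 0.888 < \<beta>\<^sub>2" "\<not> (0.888::real) < 0.888"
      using b by auto
    then have "merge_avg p = rate\<^sub>4 p" "step_rate p = rate\<^sub>1 p"
      unfolding p step_rate_def merge_avg_def rate_def by (simp_all only: if_False)
    then show ?thesis using rate_jumps(2) unfolding p by simp
  qed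
qed

lemma clg_bounds:
  assumes "2 \<le> n"
  shows "1 \<le> clg (real n)" "n \<le> 2 ^ clg (real n)" "2 ^ clg (real n) < 2 * n"
proof -
  show k: "1 \<le> clg (real n)" using less_clg_iff[of n 0] assms by simp
  show "n \<le> 2 ^ clg (real n)" using le_two_power_clg[of n] assms by simp
  obtain j where j: "clg (real n) = Suc j" using k by (cases "clg (real n)") auto
  then have "2 ^ j < n" using less_clg_iff[of n j] assms by simp
  then show "2 ^ clg (real n) < 2 * n" by (simp add: j)
qed

lemma p_of_bounds:
  assumes "2 \<le> n"
  shows "1 / 2 \<le> p_of (real n)" "p_of (real n) \<le> 1"
proof -
  have "real n \<le> real (2 ^ clg (real n))" "real (2 ^ clg (real n)) < real (2 * n)"
    using clg_bounds[OF assms] by (simp_all only: of_nat_le_iff of_nat_less_iff)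
  then show "1 / 2 \<le> p_of (real n)" "p_of (real n) \<le> 1" unfolding p_of_def by (simp_all add: field_simps)
qed

definition potential :: "nat \<Rightarrow> real" where
  "potential n = real (clg (real n)) * real n - 2 ^ clg (real n) + 2 ^ clg (real n) * profile (p_of (real n))"

lemma potential_le:
  assumes "2 \<le> n"
  shows "potential n \<le> real n * log 2 (real n) - 1.40118 * real n"
proof -
  define k where "k = clg (real n)"
  define p where "p = p_of (real n)"
  have n: "real n = p * 2 ^ k" by (simp add: p_def k_def p_of_def)
  have p: "1 / 2 \<le> p" "p \<le> 1" using p_of_bounds[OF assms] by (auto simp: p_def)
  then have "log 2 (real n) = log 2 p + real k" unfolding n by (simp add: log_mult log_nat_power)
  then have eq: "log 2 p = log 2 (real n) - real k" by simp
  have "2 ^ k * profile p \<le> 2 ^ k * (p * log 2 p - 1.40118 * p + 1)"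
    using profile_le[OF p] by (intro mult_left_mono) auto
  also have "\<dots> = real n * (log 2 (real n) - real k) - 1.40118 * real n + 2 ^ k"
    unfolding eq n by (simp add: algebra_simps)
  finally show ?thesis unfolding potential_def k_def[symmetric] p_def[symmetric] by (simp add: algebra_simps)
qed

lemma profile_1: "profile 1 = - 0.403225996"
proof -
  have "\<not> 1 < \<beta>\<^sub>1" "\<not> 1 < \<beta>\<^sub>2" using \<beta>_bounds by auto
  then show ?thesis by (simp add: profile_def prim_def)
qed

lemma profile_1_le: "profile 1 \<le> 2 * profile (1 / 2)"
proof -
  have "profile (1 / 2) = prim\<^sub>1 (1 / 2)" by (simp add: profile_def)
  moreover have "\<not> 1 < \<beta>\<^sub>1" "\<not> 1 < \<beta>\<^sub>2" using \<beta>_bounds by auto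
  then have "profile 1 = prim\<^sub>5 1" by (simp add: profile_def)
  ultimately show ?thesis using prim_jumps(5) by (simp only:)
qed

lemma potential_step:
  assumes n: "2 \<le> n" "even n"
  shows "potential n + 2 * real (clg (real n)) + step_rate (p_of (real n)) \<le> potential (n + 2)"
proof -
  define k where "k = clg (real n)"
  note k = clg_bounds[OF n(1), folded k_def]
  obtain j where j: "k = Suc j" using k(1) by (cases k) auto
  have slope: "step_rate a * (b - a) / 2 \<le> profile b - profile a" if "1 / 2 \<le> a" "a \<le> b" "b \<le> 1" for a b
    using slope_dominated_profile that unfolding slope_dominated_def by blast
  show ?thesis
  proof (cases "n = 2 ^ k")
    case False
    \<comment> \<open>Parity keeps \<open>n + 2\<close> within the same dyadic range, so only
      \<open>p\<close> moves, by \<open>2 / 2 ^ k\<close>.\<close>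
    have "even ((2::nat) ^ k)" using k(1) by simp
    then have le: "n + 2 \<le> 2 ^ k" using False k(2) n(2) by presburger
    have "2 ^ j < n + 2" using k(3) j by simp
    then have k': "clg (real (n + 2)) = k" using clg_eqI[of j "n + 2"] le j by simp
    have p': "p_of (real (n + 2)) = p_of (real n) + 2 / 2 ^ k"
      unfolding p_of_def k' k_def[symmetric] by (simp add: add_divide_distrib)
    have "step_rate (p_of (real n)) * (p_of (real (n + 2)) - p_of (real n)) / 2 \<le>
        profile (p_of (real (n + 2))) - profile (p_of (real n))"
      by (rule slope) (use p_of_bounds[of n] p_of_bounds[of "n + 2"] n p' in auto)
    then have "step_rate (p_of (real n)) / 2 ^ k \<le> profile (p_of (real (n + 2))) - profile (p_of (real n))"
      unfolding p' by simp
    then have "step_rate (p_of (real n)) \<le> 2 ^ k * profile (p_of (real (n + 2))) - 2 ^ k * profile (p_of (real n))"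
      by (simp add: field_simps)
    then show ?thesis unfolding potential_def k' k_def[symmetric] by (simp add: algebra_simps)
  next
    \<comment> \<open>Here \<open>p\<close> passes from 1 to just above \<open>1 / 2\<close>. The
      rate \<open>- 2\<close> at \<open>1 / 2\<close> allows the profile term to lose 2, which the
      larger exponent on the two new elements returns.\<close>
    case True
    have k': "clg (real (n + 2)) = Suc k" by (rule clg_eqI) (use True n in auto)
    have rn: "real n = 2 ^ k" using True by simp
    have "p_of (real n) = real n / 2 ^ k" by (simp add: p_of_def k_def)
    then have p1: "p_of (real n) = 1" using rn by simp
    have p': "p_of (real (n + 2)) = 1 / 2 + 1 / 2 ^ k"
      unfolding p_of_def k' using rn by (simp add: field_simps)
    have sr: "step_rate (1 / 2) = - 2" "step_rate 1 = 0"
      using \<beta>_bounds by (auto simp: step_rate_def rate_def)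
    have "step_rate (1 / 2) * (p_of (real (n + 2)) - 1 / 2) / 2 \<le> profile (p_of (real (n + 2))) - profile (1 / 2)"
      by (rule slope) (use p_of_bounds[of "n + 2"] n in auto)
    then have "profile 1 / 2 - 1 / 2 ^ k \<le> profile (p_of (real (n + 2)))"
      using profile_1_le unfolding sr p' by simp
    define Z where "Z = profile (p_of (real (n + 2)))"
    have "2 ^ k * profile 1 - 2 \<le> 2 * 2 ^ k * Z"
      using \<open>profile 1 / 2 - 1 / 2 ^ k \<le> profile (p_of (real (n + 2)))\<close>
      unfolding Z_def[symmetric] by (simp add: field_simps)
    moreover have "potential n = real k * 2 ^ k - 2 ^ k + 2 ^ k * profile 1"
      unfolding potential_def p1 k_def[symmetric] rn[symmetric] ..
    moreover have "potential (n + 2) = (real k + 1) * (2 ^ k + 2) - 2 * 2 ^ k + 2 * 2 ^ k * Z"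
      unfolding potential_def k' Z_def[symmetric] using rn by (simp add: algebra_simps)
    moreover have "(real k + 1) * (2 ^ k + 2) = real k * 2 ^ k + 2 * real k + 2 ^ k + 2"
      by (simp add: algebra_simps)
    ultimately show ?thesis unfolding p1 sr k_def[symmetric] by linarith
  qed
qed

text \<open>The term \<open>100 / n\<close> contributes \<open>100 * (n - 1)\<close>, which covers
  the error \<open>50 * n\<close> of 2Merge.\<close>

lemma sum_pair_cost_le:
  fixes S :: "'a::linorder set"
  assumes "finite S" and n: "card S = n" "even n" "4 \<le> n"
  shows "(\<Sum>y\<in>S. \<Sum>x\<in>S - {y}. real (pair_cost x y (sorted_list_of_set (S - {y} - {x})))) \<le>
    real n * (real n - 1) * (2 * real (clg (real n)) + step_rate (p_of (real n)) + 100 / real n)"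
proof -
  define p where "p = p_of (real n)"
  define k where "k = clg (real n)"
  have len: "length (sorted_list_of_set (S - {y} - {x})) + 2 = n" if "y \<in> S" "x \<in> S - {y}" for x y
    using that assms by simp
  have split: "real n * (real n - 1) * (2 * real k + step_rate p + 100 / real n) =
      real n * (real n - 1) * (2 * real k + step_rate p) + 100 * (real n - 1)"
    using n by (simp add: field_simps)
  show ?thesis unfolding p_def[symmetric] k_def[symmetric] split
  proof (cases "0.5511 \<le> p \<and> p \<le> 0.888")
    case True
    have "(\<Sum>y\<in>S. \<Sum>x\<in>S - {y}. real (pair_cost x y (sorted_list_of_set (S - {y} - {x})))) =
      (\<Sum>y\<in>S. \<Sum>x\<in>S - {y}. real (merge2_cost x y (sorted_list_of_set (S - {y} - {x}))))"
    proof (rule sum.cong[OF refl], rule sum.cong[OF refl])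
      fix y x assume "y \<in> S" "x \<in> S - {y}"
      from len[OF this] True show "real (pair_cost x y (sorted_list_of_set (S - {y} - {x}))) =
          real (merge2_cost x y (sorted_list_of_set (S - {y} - {x})))"
        unfolding pair_cost_def p_def by (simp only: simp_thms if_True)
    qed
    also have "\<dots> \<le> 2 * (\<Sum>j=1..<n. real j * (1 + real (first_cost n j)) + total_gap_cost j)"
      by (rule sum_merge2_pairs_le) (use assms in auto)
    also have "\<dots> \<le> real n * (real n - 1) * (2 * real k + merge_avg p) + 50 * real n"
      unfolding k_def by (rule sum_merge_cost_le_merge_avg) (use n p_def p_of_bounds[of n] in auto)
    also have "\<dots> \<le> real n * (real n - 1) * (2 * real k + step_rate p) + 100 * (real n - 1)"
      using step_rate_ge(2)[of p] True n by (intro add_mono mult_left_mono) auto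
    finally show "(\<Sum>y\<in>S. \<Sum>x\<in>S - {y}. real (pair_cost x y (sorted_list_of_set (S - {y} - {x})))) \<le> \<dots>" .
  next
    case False
    have "(\<Sum>y\<in>S. \<Sum>x\<in>S - {y}. real (pair_cost x y (sorted_list_of_set (S - {y} - {x})))) =
      (\<Sum>y\<in>S. \<Sum>x\<in>S - {y}. real (snd (rhbs x (sorted_list_of_set (S - {y} - {x}))) +
        snd (rhbs y (insort x (sorted_list_of_set (S - {y} - {x}))))))"
    proof (rule sum.cong[OF refl], rule sum.cong[OF refl])
      fix y x assume "y \<in> S" "x \<in> S - {y}"
      from len[OF this] False show "real (pair_cost x y (sorted_list_of_set (S - {y} - {x}))) =
          real (snd (rhbs x (sorted_list_of_set (S - {y} - {x}))) +
            snd (rhbs y (insort x (sorted_list_of_set (S - {y} - {x})))))"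
        unfolding pair_cost_def p_def by (simp only: simp_thms if_False)
    qed
    also have "\<dots> = real n * total_gap_cost (n - 1) + (real n - 1) * total_gap_cost n"
      using sum_rhbs_pairs[of S] assms by simp
    also have "\<dots> = real n * (real n - 1) * (2 * (real k + 1)) - (2 * real n - 1) * 2 ^ k"
    proof -
      note kb = clg_bounds[of n, folded k_def]
      obtain j where j: "k = Suc j" using kb(1) n by (cases k) auto
      \<comment> \<open>An even \<open>n \<ge> 4\<close> never follows a power of two directly, so
        \<open>n - 1\<close> and \<open>n\<close> have the same exponent.\<close>
      have "2 * 2 ^ j \<noteq> 2 * n - 2"
      proof
        assume "2 * 2 ^ j = 2 * n - 2"
        then have "n = 2 ^ j + 1" using n by simp
        moreover have "j \<noteq> 0" using calculation n by (intro notI) simp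
        ultimately show False using n(2) by simp
      qed
      then have "2 ^ j < n - 1" using kb(3) j n by simp
      then have "clg (real (n - 1)) = k" using clg_eqI[of j "n - 1"] kb(2) j n by simp
      then have t1: "total_gap_cost (n - 1) = (real n - 1) * (real k + 1) - 2 ^ k"
        using n by (simp add: total_gap_cost_def of_nat_diff)
      have t2: "total_gap_cost n = real n * (real k + 1) - 2 ^ k"
        by (simp add: total_gap_cost_def k_def)
      show ?thesis unfolding t1 t2 by (simp add: algebra_simps)
    qed
    also have "\<dots> \<le> real n * (real n - 1) * (2 * real k + (2 - 2 / p)) + 100 * (real n - 1)"
    proof -
      have q1: "real n * (real n - 1) * (2 / p) = 2 * (real n - 1) * 2 ^ k"
        using n by (simp add: p_def p_of_def k_def)
      have q2: "real n * (real n - 1) * (2 * real k + (2 - 2 / p)) =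
          real n * (real n - 1) * (2 * (real k + 1)) - real n * (real n - 1) * (2 / p)"
        by (simp add: algebra_simps)
      have q3: "(2 * real n - 1) * 2 ^ k = 2 * (real n - 1) * 2 ^ k + 2 ^ k"
        by (simp add: algebra_simps)
      have le: "a - (b + c) \<le> a - b + d" if "0 \<le> c" "0 \<le> d" for a b c d :: real using that by simp
      show ?thesis unfolding q2 q1 q3 by (rule le) (use n in auto)
    qed
    also have "\<dots> \<le> real n * (real n - 1) * (2 * real k + step_rate p) + 100 * (real n - 1)"
      using step_rate_ge(1)[of p] False n by (intro add_mono mult_left_mono) auto
    finally show "(\<Sum>y\<in>S. \<Sum>x\<in>S - {y}. real (pair_cost x y (sorted_list_of_set (S - {y} - {x})))) \<le> \<dots>" .
  qed
qed

theorem theorem1: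
  "\<exists>C::real. \<forall>n::nat. even n \<and> 2 \<le> n \<longrightarrow>
     avg_ins12 n \<le> real n * log 2 (real n) - 1.40118 * real n + C * log 2 (real n)"
proof (intro exI[of _ 57] allI impI)
  fix n :: nat assume n: "even n \<and> 2 \<le> n"
  \<comment> \<open>With the shift by 2, passing from \<open>B (m - 2)\<close> to \<open>B m\<close>
    is the potential step from \<open>m\<close> to \<open>m + 2\<close>, charged at
    \<open>m\<close>. The logarithm absorbs \<open>100 / m\<close>, because
    \<open>log 2 m - log 2 (m - 2) \<ge> 2 / m\<close>.\<close>
  define B where "B m = potential (m + 2) + 50 * log 2 (real m)" for m
  define u where "u m = 2 * real (clg (real m)) + step_rate (p_of (real m)) + 100 / real m" for m
  have ln_le_log: "ln x \<le> log 2 x" if "1 \<le> x" for x :: real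
  proof -
    have "ln x * ln 2 \<le> ln x * 1" using that ln_2_bounds by (intro mult_left_mono) auto
    then show ?thesis using ln_2_bounds by (simp add: log_def field_simps)
  qed
  have "1 \<le> B 2"
  proof -
    have "clg (real 4) = 2" using clg_two_power[of 2] by simp
    then have "potential 4 = 4 + 4 * profile 1" by (simp add: potential_def p_of_def)
    then show ?thesis by (simp add: B_def profile_1)
  qed
  moreover have "B (m - 2) + u m \<le> B m" if m: "even m" "4 \<le> m" for m
  proof -
    have "potential m + 2 * real (clg (real m)) + step_rate (p_of (real m)) \<le> potential (m + 2)"
      by (rule potential_step) (use m in auto)
    moreover have "log 2 (real (m - 2)) + 2 / real m \<le> log 2 (real m)"
    proof -
      have "ln (real (m - 2) / real m) \<le> real (m - 2) / real m - 1" by (rule ln_le_minus_one) (use m in auto)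
      moreover have "ln (real (m - 2) / real m) = - ln (real m / real (m - 2))"
        using m by (simp add: ln_div)
      moreover have "real (m - 2) / real m - 1 = - (2 / real m)" using m by (simp add: field_simps)
      ultimately have "2 / real m \<le> ln (real m / real (m - 2))" by linarith
      also have "\<dots> \<le> log 2 (real m / real (m - 2))" by (rule ln_le_log) (use m in \<open>simp add: field_simps\<close>)
      also have "\<dots> = log 2 (real m) - log 2 (real (m - 2))" using m by (simp add: log_divide_pos)
      finally show ?thesis by simp
    qed
    moreover have "m - 2 + 2 = m" using m by simp
    ultimately show ?thesis unfolding B_def u_def by simp
  qed
  moreover have "(\<Sum>y\<in>S. \<Sum>x\<in>S - {y}. real (pair_cost x y (sorted_list_of_set (S - {y} - {x}))))
      \<le> real (card S) * (real (card S) - 1) * u (card S)"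
    if "finite S" "even (card S)" "4 \<le> card S" for S :: "nat set"
    unfolding u_def by (rule sum_pair_cost_le) (use that in auto)
  ultimately have "(\<Sum>xs\<in>permutations_of_set {0..<n}. real (ins12_cost xs)) \<le>
      fact (card {0..<n}) * B (card {0..<n})"
    by (rule sum_ins12_cost_le) (use n in auto)
  then have "avg_ins12 n \<le> B n" by (simp add: avg_ins12_def field_simps)
  also have "\<dots> \<le> (real n + 2) * log 2 (real n + 2) - 1.40118 * (real n + 2) + 50 * log 2 (real n)"
    using potential_le[of "n + 2"] by (simp add: B_def add.commute)
  \<comment> \<open>The shift adds at most \<open>2 * log 2 n + 6\<close> to the leading term; as
    \<open>log 2 n \<ge> 1\<close>, the constant fits into \<open>5 * log 2 n\<close>, and
    \<open>50 + 2 + 5 = 57\<close>.\<close>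
  also have "\<dots> \<le> real n * log 2 (real n) - 1.40118 * real n + 57 * log 2 (real n)"
  proof -
    have l1: "1 \<le> log 2 (real n)" using n by simp
    have eq: "real n + 2 = real n * (1 + 2 / real n)" using n by (simp add: field_simps)
    have "log 2 (real n + 2) = log 2 (real n) + log 2 (1 + 2 / real n)"
      unfolding eq by (rule log_mult_pos) (use n in \<open>auto intro!: add_pos_nonneg\<close>)
    moreover have "log 2 (1 + 2 / real n) \<le> 3 / real n"
    proof -
      have "ln (1 + 2 / real n) \<le> 2 / real n" by (rule ln_add_one_self_le_self) simp
      also have "\<dots> \<le> 3 / real n * ln 2" using ln_2_bounds n by (simp add: field_simps)
      finally show ?thesis by (simp add: log_def field_simps)
    qed
    ultimately have l2: "log 2 (real n + 2) \<le> log 2 (real n) + 3 / real n" by simp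
    have "(real n + 2) * log 2 (real n + 2) \<le> (real n + 2) * (log 2 (real n) + 3 / real n)"
      using l2 by (intro mult_left_mono) auto
    also have "\<dots> = real n * log 2 (real n) + 2 * log 2 (real n) + 3 + 6 / real n"
      using n by (simp add: field_simps)
    also have "6 / real n \<le> 3" using n by (simp add: field_simps)
    finally have "(real n + 2) * log 2 (real n + 2) \<le> real n * log 2 (real n) + 2 * log 2 (real n) + 6" by simp
    then show ?thesis using l1 by (simp add: field_simps)
  qed
  finally show "avg_ins12 n \<le> real n * log 2 (real n) - 1.40118 * real n + 57 * log 2 (real n)" .
qed

end
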